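(* Let $p\in\{1,2,\infty\}$, let $d\ge 1$ and $\mathbf n=(n_1,\dots,n_d)$ be a tuple of positive integers, and let $k\ge 1$. Then every linear automorphism $g$ of $\mathbb R^{n_1\times\cdots\times n_d}$ with $g(B_p)=B_p$ satisfies $g(\mathrm{TH}_k(I_p))=\mathrm{TH}_k(I_p)$; that is, the symmetry group of $B_p$ acts on the theta body $\mathrm{TH}_k(I_p)$. In particular, $\mathrm{TH}_k(I_p)$ is the unit ball of a norm on $\mathbb R^{n_1\times\cdots\times n_d}$.
   Context: Let $[\mathbf n]=[n_1]\times\cdots\times[n_d]$ with $[m]=\{1,\dots,m\}$. A tensor $x\in\mathbb R^{n_1\times\cdots\times n_d}$ has entries $x_a$, $a\in[\mathbf n]$, and $\mathbb R[X]$ is the polynomial ring in the variables $x_a$, $a\in[\mathbf n]$. For $a,b\in[\mathbf n]$ let $a\wedge b=(\min(a_i,b_i))_i$ and $a\vee b=(\max(a_i,b_i))_i$. Define the ideals $I_1=\langle x_a^3-x_a\ (a\in[\mathbf n]),\ x_ax_b\ (a\ne b),\ \sum_{a}x_a^2-1\rangle$, $I_2=\langle \sum_{a}x_a^2-1,\ x_ax_b-x_{a\wedge b}x_{a\vee b}\ (a,b\in[\mathbf n])\rangle$, $I_\infty=\langle x_a^2-1\ (a\in[\mathbf n]),\ x_ax_b-x_{a\wedge b}x_{a\vee b}\ (a,b\in[\mathbf n])\rangle$. The unit ball of the nuclear $p$-norm is $B_p=\mathrm{conv}\{x^{(1)}\otimes\cdots\otimes x^{(d)}: x^{(i)}\in\mathbb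 R^{n_i},\ \|x^{(i)}\|_p=1\}$. Theta bodies. For an ideal $I$ in $\mathbb R[X]$, the degree of a class is $\deg(f+I)=\min\{\deg h: h\equiv f \bmod I\}$; $V_j=\{f+I:\deg(f+I)\le j\}$; $\Sigma_k(I)\subset V_{2k}$ is the set of classes $\sum_i h_i^2+I$ of finite sums of squares of polynomials $h_i$ with $\deg h_i\le k$; $\Sigma_k(I)^*=\{\ell\in V_{2k}^*:\ell(s)\ge 0\ \forall s\in\Sigma_k(I)\}$, where $V_{2k}^*$ is the space of linear functionals on $V_{2k}$. The theta-$k$ body of $I$ is $\mathrm{TH}_k(I)=\mathrm{cl}\{(\ell(x_a+I))_{a}:\ \ell\in\Sigma_k(I)^*,\ \ell(1+I)=1\}$. *)

theory Defs
  imports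
    "HOL-Analysis.Analysis"
    "HOL-Analysis.Finite_Function_Topology"
    "HOL-Algebra.QuotRing"
    "HOL-Library.Extended_Nat"
begin

section \<open>Tensors\<close>

text \<open>
  The shape \<open>n = [n\<^sub>1, \<dots>, n\<^sub>d]\<close> is a list of positive integers, and a multi-index is a list of the
  same length. Positions in these lists are counted from 0, the entries of a multi-index from 1.
  A tensor is a finitely supported function on all lists whose support lies in \<open>index_set n\<close>; on
  this finite-dimensional subspace the library norm (the sum of absolute values) induces the
  Euclidean topology.
\<close>

definition index_set :: "nat list \<Rightarrow> nat list set" where
  "index_set n = {a. length a = length n \<and> (\<forall>i<length n. a ! i \<in> {1..n ! i})}"

definition index_meet :: "nat list \<Rightarrow> nat list \<Rightarrow> nat list" where
  "index_meet a b = map2 min a b"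

definition index_join :: "nat list \<Rightarrow> nat list \<Rightarrow> nat list" where
  "index_join a b = map2 max a b"

definition vec_space :: "'a set \<Rightarrow> ('a \<Rightarrow>\<^sub>0 real) set" where
  "vec_space A = {x. Poly_Mapping.keys x \<subseteq> A}"

definition of_entries :: "'a set \<Rightarrow> ('a \<Rightarrow> real) \<Rightarrow> ('a \<Rightarrow>\<^sub>0 real)" where
  "of_entries A f = (\<Sum>a\<in>A. Poly_Mapping.single a (f a))"

definition outer_product :: "nat list \<Rightarrow> (nat \<Rightarrow> nat \<Rightarrow> real) \<Rightarrow> (nat list \<Rightarrow>\<^sub>0 real)" where
  "outer_product n v = of_entries (index_set n) (\<lambda>a. \<Prod>i<length n. v i (a ! i))"

text \<open>The \<open>p\<close>-norm of the vector \<open>(v 1, \<dots>, v m)\<close>, for \<open>p\<close> a positive integer or \<open>\<infinity>\<close>.\<close>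

definition p_norm :: "enat \<Rightarrow> nat \<Rightarrow> (nat \<Rightarrow> real) \<Rightarrow> real" where
  "p_norm p m v =
    (case p of
       enat q \<Rightarrow> root q (\<Sum>j=1..m. \<bar>v j\<bar> ^ q)
     | \<infinity> \<Rightarrow> Max ((\<lambda>j. \<bar>v j\<bar>) ` {1..m}))"

definition nuclear_ball :: "enat \<Rightarrow> nat list \<Rightarrow> (nat list \<Rightarrow>\<^sub>0 real) set" where
  "nuclear_ball p n =
    convex hull {outer_product n v | v. \<forall>i<length n. p_norm p (n ! i) (v i) = 1}"

definition linear_automorphism_on :: "'v::real_vector set \<Rightarrow> ('v \<Rightarrow> 'v) \<Rightarrow> bool" where
  "linear_automorphism_on S g \<longleftrightarrow>
    bij_betw g S S \<and>
    (\<forall>x\<in>S. \<forall>y\<in>S. g (x + y) = g x + g y) \<and>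
    (\<forall>c. \<forall>x\<in>S. g (c *\<^sub>R x) = c *\<^sub>R g x)"

definition norm_on :: "'v::real_vector set \<Rightarrow> ('v \<Rightarrow> real) \<Rightarrow> bool" where
  "norm_on S N \<longleftrightarrow>
    (\<forall>x\<in>S. N x \<ge> 0) \<and>
    (\<forall>x\<in>S. N x = 0 \<longleftrightarrow> x = 0) \<and>
    (\<forall>c. \<forall>x\<in>S. N (c *\<^sub>R x) = \<bar>c\<bar> * N x) \<and>
    (\<forall>x\<in>S. \<forall>y\<in>S. N (x + y) \<le> N x + N y)"

section \<open>Polynomials and theta bodies\<close>

text \<open>
  A monomial is a finitely supported exponent function, and a polynomial a finitely supported
  coefficient function on monomials, multiplied by convolution. \<open>poly_ring A\<close> is the ring of
  real polynomials in the variables \<open>X\<^sub>a\<close> with \<open>a \<in> A\<close> only.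
\<close>

type_synonym 'a mpoly = "('a \<Rightarrow>\<^sub>0 nat) \<Rightarrow>\<^sub>0 real"

definition poly_ring :: "'a set \<Rightarrow> 'a mpoly ring" where
  "poly_ring A =
    \<lparr>carrier = {f. \<forall>m\<in>Poly_Mapping.keys f. Poly_Mapping.keys m \<subseteq> A},
     mult = (*), one = 1, zero = 0, add = (+)\<rparr>"

definition var :: "'a \<Rightarrow> 'a mpoly" where
  "var a = Poly_Mapping.single (Poly_Mapping.single a 1) 1"

definition const :: "real \<Rightarrow> 'a mpoly" where
  "const c = Poly_Mapping.single 0 c"

definition total_deg :: "'a mpoly \<Rightarrow> nat" where
  "total_deg f =
    Max (insert 0 ((\<lambda>m. \<Sum>a\<in>Poly_Mapping.keys m. Poly_Mapping.lookup m a) ` Poly_Mapping.keys f))"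

definition class_deg :: "'a mpoly set \<Rightarrow> nat" where
  "class_deg F = (LEAST j. \<exists>h\<in>F. total_deg h = j)"

definition classes_up_to :: "'a set \<Rightarrow> 'a mpoly set \<Rightarrow> nat \<Rightarrow> 'a mpoly set set" where
  "classes_up_to A I j = {F \<in> carrier (poly_ring A Quot I). class_deg F \<le> j}"

definition sos_classes :: "'a set \<Rightarrow> 'a mpoly set \<Rightarrow> nat \<Rightarrow> 'a mpoly set set" where
  "sos_classes A I k =
    {I +>\<^bsub>poly_ring A\<^esub> (\<Sum>h\<leftarrow>hs. h ^ 2) | hs.
      \<forall>h\<in>set hs. h \<in> carrier (poly_ring A) \<and> total_deg h \<le> k}"

text \<open>
  Functionals are functions on all sets of polynomials of which only the values on the classes in
  \<open>classes_up_to A I j\<close> matter. Scalars act on the quotient through the classes of constants.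
\<close>

definition linear_functionals ::
    "'a set \<Rightarrow> 'a mpoly set \<Rightarrow> nat \<Rightarrow> ('a mpoly set \<Rightarrow> real) set" where
  "linear_functionals A I j =
    {l. (\<forall>F\<in>classes_up_to A I j. \<forall>G\<in>classes_up_to A I j.
           l (F \<oplus>\<^bsub>poly_ring A Quot I\<^esub> G) = l F + l G) \<and>
        (\<forall>c. \<forall>F\<in>classes_up_to A I j.
           l ((I +>\<^bsub>poly_ring A\<^esub> const c) \<otimes>\<^bsub>poly_ring A Quot I\<^esub> F) = c * l F)}"

definition sos_dual ::
    "'a set \<Rightarrow> 'a mpoly set \<Rightarrow> nat \<Rightarrow> ('a mpoly set \<Rightarrow> real) set" where
  "sos_dual A I k =
    {l \<in> linear_functionals A I (2 * k). \<forall>F\<in>sos_classes A I k. l F \<ge> 0}"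

definition theta_body :: "'a set \<Rightarrow> 'a mpoly set \<Rightarrow> nat \<Rightarrow> ('a \<Rightarrow>\<^sub>0 real) set" where
  "theta_body A I k =
    closure {of_entries A (\<lambda>a. l (I +>\<^bsub>poly_ring A\<^esub> var a)) | l.
      l \<in> sos_dual A I k \<and> l (I +>\<^bsub>poly_ring A\<^esub> 1) = 1}"

section \<open>The ideals\<close>

definition ideal_1 :: "nat list \<Rightarrow> nat list mpoly set" where
  "ideal_1 n =
    Idl\<^bsub>poly_ring (index_set n)\<^esub>
      ({var a ^ 3 - var a | a. a \<in> index_set n} \<union>
       {var a * var b | a b. a \<in> index_set n \<and> b \<in> index_set n \<and> a \<noteq> b} \<union>
       {(\<Sum>a\<in>index_set n. var a ^ 2) - 1})"

definition ideal_2 :: "nat list \<Rightarrow> nat list mpoly set" where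
  "ideal_2 n =
    Idl\<^bsub>poly_ring (index_set n)\<^esub>
      ({(\<Sum>a\<in>index_set n. var a ^ 2) - 1} \<union>
       {var a * var b - var (index_meet a b) * var (index_join a b) | a b.
          a \<in> index_set n \<and> b \<in> index_set n})"

definition ideal_inf :: "nat list \<Rightarrow> nat list mpoly set" where
  "ideal_inf n =
    Idl\<^bsub>poly_ring (index_set n)\<^esub>
      ({var a ^ 2 - 1 | a. a \<in> index_set n} \<union>
       {var a * var b - var (index_meet a b) * var (index_join a b) | a b.
          a \<in> index_set n \<and> b \<in> index_set n})"

definition nuclear_ideal :: "enat \<Rightarrow> nat list \<Rightarrow> nat list mpoly set" where
  "nuclear_ideal p n =
    (if p = 1 then ideal_1 n
     else if p = 2 then ideal_2 n
     else if p = \<infinity> then ideal_inf n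
     else undefined)"

end

theory Submission
  imports Defs
begin

text \<open>
  The ball and the ideal are described by one set of points. For each \<open>p\<close> there is a set \<open>V\<close> of
  rank-one tensors (\<open>signed_units\<close>, \<open>unit_rank_one\<close>, \<open>sign_tensors\<close> for \<open>p = 1, 2, \<infinity>\<close>) with three
  properties: its convex hull is the nuclear ball, all its points have the same Euclidean length,
  and the ideal of the norm is exactly the ideal of all polynomials that vanish on \<open>V\<close>.

  From these three properties the symmetry follows without knowing the isometries of the nuclear
  norm. A sphere is strictly convex, so every point of \<open>V\<close> is an extreme point of the ball; a
  linear automorphism \<open>g\<close> of the ball permutes its extreme points and hence maps \<open>V\<close> into itself.
  Therefore the substitution \<open>f \<mapsto> f \<circ> g\<close> preserves the vanishing ideal of \<open>V\<close>. It also preserves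
  degrees, so composing with it sends an admissible functional (a pseudo-expectation) to an
  admissible functional, and on the level of first moments this is the action of \<open>g\<close>. This gives
  \<open>g (TH) \<subseteq> TH\<close>, and the inverse of \<open>g\<close> gives the other inclusion (\<open>theta_body_image_eq\<close>).

  For the norm, the theta body is closed and convex by construction, it contains \<open>V\<close> because point
  evaluations are pseudo-expectations, and it is symmetric because \<open>-V = V\<close> makes \<open>x \<mapsto> -x\<close> one of
  the symmetries. The ball contains the coordinate tensors, so the theta body contains a
  neighbourhood of the origin, and it is bounded because the sum of the squares of the variables
  is constant modulo the ideal. A set of this kind is the unit ball of its Minkowski gauge
  (\<open>norm_on_of_unit_ball\<close>).

  The real work is the identification of the ideals. For \<open>p = 1\<close> and \<open>p = \<infinity>\<close> the ideal contains,
  for every variable, a polynomial with simple real roots. Lagrange interpolation on the resulting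
  finite grid then shows that the ideal is determined by its zeros (\<open>grid_ideal_membership\<close>), and
  it remains to find the zeros on the grid. For \<open>p = 2\<close> the zero set is in general infinite. There
  the relation \<open>\<Sum> X\<^sub>a\<^sup>2 = 1\<close> is used to replace a polynomial by one homogeneous form of even and
  one of odd degree. Both forms vanish on all rank-one tensors: the two are separated by \<open>x \<mapsto> -x\<close>,
  and homogeneity removes the normalisation. A form vanishing on all rank-one tensors lies in the
  ideal of the meet-join binomials, since these binomials identify any two monomials that agree as
  functions on rank-one tensors (\<open>toric_congruence\<close>), and distinct such functions are linearly
  independent, being multiplicative characters (\<open>characters_independent\<close>).
\<close>

section \<open>Evaluation and substitution of polynomials\<close>

lemma lookup_scaleR [simp]:
  "Poly_Mapping.lookup (r *\<^sub>R x) i = r *\<^sub>R Poly_Mapping.lookup x i"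
proof -
  have "finite {i. r *\<^sub>R Poly_Mapping.lookup x i \<noteq> 0}"
    by (rule finite_subset[OF _ finite_lookup[of x]]) auto
  then show ?thesis by (simp add: scaleR_poly_mapping_def)
qed

lemma scaleR_conv_single_mult:
  fixes x :: "'a::comm_monoid_add \<Rightarrow>\<^sub>0 'b::real_algebra_1"
  shows "r *\<^sub>R x = Poly_Mapping.single 0 (of_real r) * x"
  unfolding mult_map_scale_conv_mult[symmetric]
  by (rule poly_mapping_eqI) (simp add: Poly_Mapping.map.rep_eq when_def of_real_def)

text \<open>
  With this instance the polynomials themselves are a commutative real algebra, so that one notion
  of homomorphism covers evaluation at a point (values in the reals) and substitution (values in
  the polynomials).
\<close>

instance poly_mapping :: (comm_monoid_add, "{comm_ring_1, real_algebra_1}") real_algebra_1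
proof
  fix r :: real and x y :: "'a \<Rightarrow>\<^sub>0 'b"
  show "r *\<^sub>R x * y = r *\<^sub>R (x * y)"
    by (simp add: scaleR_conv_single_mult mult.assoc)
  show "x * r *\<^sub>R y = r *\<^sub>R (x * y)"
    by (simp add: scaleR_conv_single_mult mult.left_commute)
qed

definition monomial_value :: "('a \<Rightarrow> 'r::comm_ring_1) \<Rightarrow> ('a \<Rightarrow>\<^sub>0 nat) \<Rightarrow> 'r" where
  "monomial_value \<sigma> m = (\<Prod>a\<in>Poly_Mapping.keys m. \<sigma> a ^ Poly_Mapping.lookup m a)"

text \<open>
  The homomorphism of real algebras that sends each variable to its image under \<open>\<sigma>\<close>.
\<close>

definition poly_hom :: "('a \<Rightarrow> 'r::{comm_ring_1, real_algebra_1}) \<Rightarrow> 'a mpoly \<Rightarrow> 'r" where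
  "poly_hom \<sigma> f = (\<Sum>m\<in>Poly_Mapping.keys f. Poly_Mapping.lookup f m *\<^sub>R monomial_value \<sigma> m)"

lemma monomial_value_superset:
  assumes "finite K" "Poly_Mapping.keys m \<subseteq> K"
  shows "monomial_value \<sigma> m = (\<Prod>a\<in>K. \<sigma> a ^ Poly_Mapping.lookup m a)"
  unfolding monomial_value_def
  by (rule prod.mono_neutral_left) (use assms in \<open>auto simp: in_keys_iff\<close>)

lemma monomial_value_zero [simp]: "monomial_value \<sigma> 0 = 1"
  by (simp add: monomial_value_def)

lemma monomial_value_single [simp]: "monomial_value \<sigma> (Poly_Mapping.single a k) = \<sigma> a ^ k"
  by (cases "k = 0") (auto simp: monomial_value_def)

lemma monomial_value_add:
  "monomial_value \<sigma> (m + m') = monomial_value \<sigma> m * monomial_value \<sigma> m'"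
proof -
  let ?K = "Poly_Mapping.keys m \<union> Poly_Mapping.keys m'"
  have *: "Poly_Mapping.keys (m + m') \<subseteq> ?K"
    by (rule keys_add)
  show ?thesis
    by (subst (1 2 3) monomial_value_superset[of ?K])
       (use * in \<open>auto simp: lookup_add power_add prod.distrib\<close>)
qed

lemma poly_hom_superset:
  assumes "finite K" "Poly_Mapping.keys f \<subseteq> K"
  shows "poly_hom \<sigma> f = (\<Sum>m\<in>K. Poly_Mapping.lookup f m *\<^sub>R monomial_value \<sigma> m)"
  unfolding poly_hom_def
  by (rule sum.mono_neutral_left) (use assms in \<open>auto simp: in_keys_iff\<close>)

lemma poly_hom_single: "poly_hom \<sigma> (Poly_Mapping.single m c) = c *\<^sub>R monomial_value \<sigma> m"
  by (cases "c = 0") (auto simp: poly_hom_def)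

lemma poly_hom_add: "poly_hom \<sigma> (f + g) = poly_hom \<sigma> f + poly_hom \<sigma> g"
proof -
  let ?K = "Poly_Mapping.keys f \<union> Poly_Mapping.keys g"
  have *: "Poly_Mapping.keys (f + g) \<subseteq> ?K"
    by (rule keys_add)
  show ?thesis
    by (subst (1 2 3) poly_hom_superset[of ?K])
       (use * in \<open>auto simp: lookup_add scaleR_add_left sum.distrib\<close>)
qed

lemma poly_hom_zero [simp]: "poly_hom \<sigma> 0 = 0"
  by (simp add: poly_hom_def)

lemma poly_hom_sum: "poly_hom \<sigma> (\<Sum>i\<in>S. f i) = (\<Sum>i\<in>S. poly_hom \<sigma> (f i))"
  by (induction S rule: infinite_finite_induct) (auto simp: poly_hom_add)

lemma sum_single_lookup: "f =
    (\<Sum>m\<in>Poly_Mapping.keys f. Poly_Mapping.single m (Poly_Mapping.lookup f m))"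
  by (rule poly_mapping_eqI) (auto simp: lookup_sum lookup_single when_def sum.delta in_keys_iff)

lemma poly_hom_mult: "poly_hom \<sigma> (f * g) = poly_hom \<sigma> f * poly_hom \<sigma> g"
proof -
  have "poly_hom \<sigma> (f * g) = poly_hom \<sigma>
      ((\<Sum>m\<in>Poly_Mapping.keys f. Poly_Mapping.single m (Poly_Mapping.lookup f m)) *
       (\<Sum>m\<in>Poly_Mapping.keys g. Poly_Mapping.single m (Poly_Mapping.lookup g m)))"
    using sum_single_lookup[of f] sum_single_lookup[of g] by simp
  also have "\<dots> = poly_hom \<sigma> f * poly_hom \<sigma> g"
    by (simp add: sum_product poly_hom_sum mult_single poly_hom_single monomial_value_add
        poly_hom_def[of _ f] poly_hom_def[of _ g] mult.commute)
  finally show ?thesis .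
qed

lemma poly_hom_const [simp]: "poly_hom \<sigma> (const c) = c *\<^sub>R 1"
  by (simp add: const_def poly_hom_single)

lemma poly_hom_var [simp]: "poly_hom \<sigma> (var a) = \<sigma> a"
  by (simp add: var_def poly_hom_single)

lemma const_1 [simp]: "const 1 = 1"
  by (simp add: const_def)

lemma const_0 [simp]: "const 0 = 0"
  by (simp add: const_def)

lemma poly_hom_one [simp]: "poly_hom \<sigma> 1 = 1"
  using poly_hom_const[of \<sigma> 1] by (simp del: poly_hom_const)

lemma poly_hom_power: "poly_hom \<sigma> (f ^ k) = poly_hom \<sigma> f ^ k"
  by (induction k) (auto simp: poly_hom_mult)

lemma const_mult: "const c * f = c *\<^sub>R f"
  by (simp add: scaleR_conv_single_mult const_def)

lemma scaleR_one_mpoly: "c *\<^sub>R (1 :: 'a mpoly) = const c"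
  using const_mult[of c "1 :: 'a mpoly"] by simp

lemma poly_hom_scaleR: "poly_hom \<sigma> (c *\<^sub>R f) = c *\<^sub>R poly_hom \<sigma> f"
  by (simp add: const_mult[symmetric] poly_hom_mult)

lemma poly_hom_uminus: "poly_hom \<sigma> (- f) = - poly_hom \<sigma> f"
  using poly_hom_scaleR[of \<sigma> "-1" f] by simp

lemma poly_hom_diff: "poly_hom \<sigma> (f - g) = poly_hom \<sigma> f - poly_hom \<sigma> g"
  using poly_hom_add[of \<sigma> f "-g"] by (simp add: poly_hom_uminus)

lemmas poly_hom_simps = poly_hom_add poly_hom_mult poly_hom_power poly_hom_scaleR poly_hom_uminus
  poly_hom_diff poly_hom_sum

lemma prod_single_one:
  "(\<Prod>a\<in>S. Poly_Mapping.single (g a) (1::real)) = Poly_Mapping.single (\<Sum>a\<in>S. g a) 1"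
  by (induction S rule: infinite_finite_induct) (auto simp: mult_single)

lemma var_power: "var a ^ k = Poly_Mapping.single (Poly_Mapping.single a k) 1"
  by (induction k) (auto simp: var_def mult_single single_add[symmetric])

text \<open>
  Together with \<open>sum_single_lookup\<close> this writes every polynomial as a combination of products of
  variables, which is what makes structural induction on polynomials possible.
\<close>

lemma monomial_value_var: "monomial_value var m = Poly_Mapping.single m 1"
  unfolding monomial_value_def var_power prod_single_one
  by (subst (4) sum_single_lookup) (rule refl)

lemma poly_hom_var_id: "poly_hom var f = f"
proof -
  have "poly_hom var f = (\<Sum>m\<in>Poly_Mapping.keys f. Poly_Mapping.single m (Poly_Mapping.lookup f m))"
    unfolding poly_hom_def monomial_value_var
    by (rule sum.cong) (auto simp: scaleR_conv_single_mult mult_single)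
  then show ?thesis using sum_single_lookup[of f] by simp
qed

section \<open>The ring of polynomials in a set of variables\<close>

lemma mem_poly_ring:
  "f \<in> carrier (poly_ring A) \<longleftrightarrow> (\<forall>m\<in>Poly_Mapping.keys f. Poly_Mapping.keys m \<subseteq> A)"
  by (simp add: poly_ring_def)

lemma poly_ring_simps [simp]:
  "mult (poly_ring A) = (*)" "one (poly_ring A) = 1" "zero (poly_ring A) = 0"
      "add (poly_ring A) = (+)"
  by (simp_all add: poly_ring_def)

lemma poly_ring_add: "\<lbrakk>f \<in> carrier (poly_ring A); g \<in> carrier (poly_ring A)\<rbrakk> \<Longrightarrow>
    f + g \<in> carrier (poly_ring A)"
  using keys_add[of f g] by (auto simp: mem_poly_ring)

lemma poly_ring_mult:
  assumes "f \<in> carrier (poly_ring A)" "g \<in> carrier (poly_ring A)"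
  shows "f * g \<in> carrier (poly_ring A)"
  unfolding mem_poly_ring
proof
  fix m assume "m \<in> Poly_Mapping.keys (f * g)"
  then obtain a b where "m = a + b" "a \<in> Poly_Mapping.keys f" "b \<in> Poly_Mapping.keys g"
    using keys_mult[of f g] by auto
  then show "Poly_Mapping.keys m \<subseteq> A"
    using assms keys_add[of a b] by (fastforce simp: mem_poly_ring)
qed

lemma poly_ring_const: "const c \<in> carrier (poly_ring A)"
  by (cases "c = 0") (auto simp: mem_poly_ring const_def)

lemma poly_ring_var: "a \<in> A \<Longrightarrow> var a \<in> carrier (poly_ring A)"
  by (auto simp: mem_poly_ring var_def)

lemma poly_ring_zero: "0 \<in> carrier (poly_ring A)" and poly_ring_one: "1 \<in> carrier (poly_ring A)"
  using poly_ring_const[of 0] poly_ring_const[of 1] by auto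

lemma poly_ring_scaleR: "f \<in> carrier (poly_ring A) \<Longrightarrow> c *\<^sub>R f \<in> carrier (poly_ring A)"
  using poly_ring_mult[OF poly_ring_const[of c]] by (simp add: const_mult)

lemma poly_ring_uminus: "f \<in> carrier (poly_ring A) \<Longrightarrow> - f \<in> carrier (poly_ring A)"
  by (simp add: mem_poly_ring)

lemma poly_ring_diff: "\<lbrakk>f \<in> carrier (poly_ring A); g \<in> carrier (poly_ring A)\<rbrakk> \<Longrightarrow>
    f - g \<in> carrier (poly_ring A)"
  using poly_ring_add[of f A "-g"] by (simp add: poly_ring_uminus)

lemma poly_ring_sum: "(\<And>i. i \<in> S \<Longrightarrow> f i \<in> carrier (poly_ring A)) \<Longrightarrow>
    (\<Sum>i\<in>S. f i) \<in> carrier (poly_ring A)"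
  by (induction S rule: infinite_finite_induct) (auto simp: poly_ring_zero poly_ring_add)

lemma poly_ring_prod: "(\<And>i. i \<in> S \<Longrightarrow> f i \<in> carrier (poly_ring A)) \<Longrightarrow>
    (\<Prod>i\<in>S. f i) \<in> carrier (poly_ring A)"
  by (induction S rule: infinite_finite_induct) (auto simp: poly_ring_one poly_ring_mult)

lemma poly_ring_power: "f \<in> carrier (poly_ring A) \<Longrightarrow> f ^ k \<in> carrier (poly_ring A)"
  by (induction k) (auto simp: poly_ring_one poly_ring_mult)

lemmas poly_ring_closed = poly_ring_add poly_ring_mult poly_ring_const poly_ring_var poly_ring_zero
  poly_ring_one poly_ring_scaleR poly_ring_uminus poly_ring_diff poly_ring_sum poly_ring_prod
  poly_ring_power

lemma cring_poly_ring: "cring (poly_ring A)"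
proof (intro cringI abelian_groupI comm_monoidI)
  show "\<exists>g\<in>carrier (poly_ring A). g \<oplus>\<^bsub>poly_ring A\<^esub> f = \<zero>\<^bsub>poly_ring A\<^esub>"
    if "f \<in> carrier (poly_ring A)" for f
    using that by (intro bexI[of _ "-f"]) (auto simp: poly_ring_closed)
qed (auto simp: poly_ring_closed algebra_simps)

lemma poly_hom_closed:
  assumes "f \<in> carrier (poly_ring A)" "\<And>a. a \<in> A \<Longrightarrow> \<sigma> a \<in> carrier (poly_ring B)"
  shows "poly_hom \<sigma> f \<in> carrier (poly_ring B)"
  unfolding poly_hom_def monomial_value_def
  by (intro poly_ring_sum poly_ring_scaleR poly_ring_prod poly_ring_power assms(2))
     (use assms(1) in \<open>auto simp: mem_poly_ring\<close>)

text \<open>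
  A polynomial equals its own image under the substitution that fixes all variables; unfolding
  that image exhibits it as built from constants and variables by sums and products.
\<close>

lemma poly_ring_induct [consumes 1, case_names const var add mult]:
  assumes f: "f \<in> carrier (poly_ring A)"
    and const: "\<And>c. P (const c)"
    and var: "\<And>a. a \<in> A \<Longrightarrow> P (var a)"
    and add: "\<And>f g. \<lbrakk>f \<in> carrier (poly_ring A); g \<in> carrier (poly_ring A); P f; P g\<rbrakk> \<Longrightarrow> P (f + g)"
    and mult: "\<And>f g. \<lbrakk>f \<in> carrier (poly_ring A); g \<in> carrier (poly_ring A); P f; P g\<rbrakk> \<Longrightarrow> P (f * g)"
  shows "P f"
proof -
  define Q where "Q f \<longleftrightarrow> f \<in> carrier (poly_ring A) \<and> P f" for f
  have Qc: "Q (const c)" for c using const by (simp add: Q_def poly_ring_const)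
  have Qv: "Q (var a)" if "a \<in> A" for a using var that by (simp add: Q_def poly_ring_var)
  have Qa: "Q (f + g)" if "Q f" "Q g" for f g using add that by (simp add: Q_def poly_ring_add)
  have Qm: "Q (f * g)" if "Q f" "Q g" for f g using mult that by (simp add: Q_def poly_ring_mult)
  have Qpow: "Q (f ^ k)" if "Q f" for f k
    using Qc[of 1] by (induction k) (auto simp: Qm that)
  have Qprod: "Q (\<Prod>i\<in>S. g i)" if "\<And>i. i \<in> S \<Longrightarrow> Q (g i)" for S and g :: "'a \<Rightarrow> 'a mpoly"
    using that Qc[of 1] by (induction S rule: infinite_finite_induct) (auto simp: Qm)
  have Qsum: "Q (\<Sum>i\<in>S. g i)" if "\<And>i. i \<in> S \<Longrightarrow> Q (g i)" for S and g :: "('a \<Rightarrow>\<^sub>0 nat) \<Rightarrow> 'a mpoly"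
    using that Qc[of 0] by (induction S rule: infinite_finite_induct) (auto simp: Qa)
  have "Q (poly_hom var f)"
    unfolding poly_hom_def monomial_value_def const_mult[symmetric] using f
    by (intro Qsum Qm Qc Qprod Qpow Qv) (auto simp: mem_poly_ring)
  then show ?thesis by (simp add: poly_hom_var_id Q_def)
qed

text \<open>
  This is \<open>f(g(x)) = (f \<circ> g)(x)\<close> when \<open>\<tau>\<close> is a point and \<open>\<sigma>\<close> lists the coordinates of \<open>g\<close>.
\<close>

lemma poly_hom_compose: 
  "poly_hom \<tau> (poly_hom \<sigma> f) = poly_hom (\<lambda>a. poly_hom \<tau> (\<sigma> a)) f"
proof -
  have "f \<in> carrier (poly_ring UNIV)" by (simp add: mem_poly_ring)
  then show ?thesis
    by (induction rule: poly_ring_induct) (auto simp: poly_hom_simps scaleR_one_mpoly)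
qed

lemma poly_hom_cong:
  assumes "f \<in> carrier (poly_ring A)" "\<And>a. a \<in> A \<Longrightarrow> \<sigma> a = \<tau> a"
  shows "poly_hom \<sigma> f = poly_hom \<tau> f"
  using assms by (induction rule: poly_ring_induct) (auto simp: poly_hom_simps)

section \<open>Total degree\<close>

definition monomial_deg :: "('a \<Rightarrow>\<^sub>0 nat) \<Rightarrow> nat" where
  "monomial_deg m = (\<Sum>a\<in>Poly_Mapping.keys m. Poly_Mapping.lookup m a)"

lemma monomial_deg_add: "monomial_deg (m + m') = monomial_deg m + monomial_deg m'"
  unfolding monomial_deg_def by (rule setsum_keys_plus_distrib) auto

lemma total_deg_le_iff: "total_deg f \<le> j \<longleftrightarrow> (\<forall>m\<in>Poly_Mapping.keys f. monomial_deg m \<le> j)"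
  by (auto simp: total_deg_def monomial_deg_def)

lemma total_deg_add_le: "\<lbrakk>total_deg f \<le> j; total_deg g \<le> j\<rbrakk> \<Longrightarrow> total_deg (f + g) \<le> j"
  using keys_add[of f g] by (auto simp: total_deg_le_iff)

lemma total_deg_mult_le:
  assumes "total_deg f \<le> i" "total_deg g \<le> j"
  shows "total_deg (f * g) \<le> i + j"
  unfolding total_deg_le_iff
proof
  fix m assume "m \<in> Poly_Mapping.keys (f * g)"
  then obtain a b where "m = a + b" "a \<in> Poly_Mapping.keys f" "b \<in> Poly_Mapping.keys g"
    using keys_mult[of f g] by auto
  then show "monomial_deg m \<le> i + j"
    using assms by (fastforce simp: total_deg_le_iff monomial_deg_add intro: add_mono)
qed

lemma total_deg_const [simp]: "total_deg (const c) = 0"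
proof -
  have "total_deg (const c) \<le> 0"
    unfolding total_deg_le_iff by (cases "c = 0") (auto simp: const_def monomial_deg_def)
  then show ?thesis by simp
qed

lemma total_deg_0 [simp]: "total_deg 0 = 0" and total_deg_1 [simp]: "total_deg 1 = 0"
  using total_deg_const[of 0] total_deg_const[of 1] by (auto simp del: total_deg_const)

lemma total_deg_var_le: "total_deg (var a) \<le> 1"
  unfolding total_deg_le_iff by (auto simp: var_def monomial_deg_def)

lemma total_deg_scaleR_le: "total_deg f \<le> j \<Longrightarrow> total_deg (c *\<^sub>R f) \<le> j"
  using total_deg_mult_le[of "const c" 0 f j] by (simp add: const_mult)

lemma total_deg_uminus [simp]: "total_deg (- f) = total_deg f"
  by (simp add: total_deg_def)

lemma total_deg_diff_le: "\<lbrakk>total_deg f \<le> j; total_deg g \<le> j\<rbrakk> \<Longrightarrow> total_deg (f - g) \<le> j"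
  using total_deg_add_le[of f j "-g"] by simp

lemma total_deg_sum_le: "(\<And>i. i \<in> S \<Longrightarrow> total_deg (f i) \<le> j) \<Longrightarrow> total_deg (\<Sum>i\<in>S. f i) \<le> j"
  by (induction S rule: infinite_finite_induct) (auto intro: total_deg_add_le)

lemma total_deg_prod_le:
  "(\<And>i. i \<in> S \<Longrightarrow> total_deg (f i) \<le> d i) \<Longrightarrow> total_deg (\<Prod>i\<in>S. f i) \<le> (\<Sum>i\<in>S. d i)"
  by (induction S rule: infinite_finite_induct) (auto intro: total_deg_mult_le)

lemma total_deg_power_le: "total_deg f \<le> j \<Longrightarrow> total_deg (f ^ k) \<le> k * j"
  by (induction k) (auto intro: total_deg_mult_le)

text \<open>
  Substituting polynomials of degree at most one does not raise the degree; this is what keeps the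
  truncation of the theta body at level \<open>k\<close> invariant under linear changes of variables.
\<close>

lemma total_deg_poly_hom_le:
  assumes f: "f \<in> carrier (poly_ring A)" "total_deg f \<le> j"
    and \<sigma>: "\<And>a. a \<in> A \<Longrightarrow> total_deg (\<sigma> a) \<le> 1"
  shows "total_deg (poly_hom \<sigma> f) \<le> j"
  unfolding poly_hom_def
proof (intro total_deg_sum_le total_deg_scaleR_le)
  fix m assume m: "m \<in> Poly_Mapping.keys f"
  have "total_deg (monomial_value \<sigma> m) \<le> monomial_deg m"
    unfolding monomial_value_def monomial_deg_def using m f(1)
    by (intro total_deg_prod_le) (use total_deg_power_le[OF \<sigma>] in \<open>fastforce simp: mem_poly_ring\<close>)
  also have "\<dots> \<le> j" using m f(2) by (simp add: total_deg_le_iff)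
  finally show "total_deg (monomial_value \<sigma> m) \<le> j" .
qed

section \<open>Ideals and quotients\<close>

lemma ideal_poly_ring_closed:
  assumes "ideal I (poly_ring A)"
  shows ideal_poly_ring_carrier: "\<And>f. f \<in> I \<Longrightarrow> f \<in> carrier (poly_ring A)"
    and ideal_poly_ring_zero: "0 \<in> I"
    and ideal_poly_ring_add: "\<And>f g. \<lbrakk>f \<in> I; g \<in> I\<rbrakk> \<Longrightarrow> f + g \<in> I"
    and ideal_poly_ring_mult: "\<And>f g. \<lbrakk>f \<in> carrier (poly_ring A); g \<in> I\<rbrakk> \<Longrightarrow> f * g \<in> I"
    and ideal_poly_ring_scaleR: "\<And>c f. f \<in> I \<Longrightarrow> c *\<^sub>R f \<in> I"
    and ideal_poly_ring_uminus: "\<And>f. f \<in> I \<Longrightarrow> - f \<in> I"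
    and ideal_poly_ring_diff: "\<And>f g. \<lbrakk>f \<in> I; g \<in> I\<rbrakk> \<Longrightarrow> f - g \<in> I"
proof -
  interpret ideal I "poly_ring A" by fact
  show carr: "f \<in> carrier (poly_ring A)" if "f \<in> I" for f using that by (rule a_Hcarr)
  show "0 \<in> I" using additive_subgroup.zero_closed[OF is_additive_subgroup] by simp
  show add: "f + g \<in> I" if "f \<in> I" "g \<in> I" for f g
      using additive_subgroup.a_closed[OF is_additive_subgroup that] by simp
  show mult: "f * g \<in> I" if "f \<in> carrier (poly_ring A)" "g \<in> I" for f g
    using I_l_closed[OF that(2,1)] by simp
  show scale: "c *\<^sub>R f \<in> I" if "f \<in> I" for c f
    using mult[OF poly_ring_const that, of c] by (simp add: const_mult)
  show um: "- f \<in> I" if "f \<in> I" for f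
    using scale[OF that, of "-1"] by simp
  show "f - g \<in> I" if "f \<in> I" "g \<in> I" for f g
    using add[OF that(1) um[OF that(2)]] by simp
qed

lemma ideal_poly_ring_sum:
  assumes "ideal I (poly_ring A)" "\<And>i. i \<in> S \<Longrightarrow> f i \<in> I"
  shows "(\<Sum>i\<in>S. f i) \<in> I"
  using assms(2)
  by (induction S rule: infinite_finite_induct)
     (auto intro: ideal_poly_ring_zero[OF assms(1)] ideal_poly_ring_add[OF assms(1)])

lemma mem_coset_iff: "g \<in> I +>\<^bsub>poly_ring A\<^esub> f \<longleftrightarrow> g - f \<in> I"
proof
  show "g - f \<in> I" if "g \<in> I +>\<^bsub>poly_ring A\<^esub> f"
    using that by (auto simp: a_r_coset_def')
  show "g \<in> I +>\<^bsub>poly_ring A\<^esub> f" if "g - f \<in> I"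
    unfolding a_r_coset_def' using that by (auto intro!: bexI[of _ "g - f"])
qed

lemma coset_eq_iff:
  assumes "ideal I (poly_ring A)"
  shows "I +>\<^bsub>poly_ring A\<^esub> f = I +>\<^bsub>poly_ring A\<^esub> g \<longleftrightarrow> f - g \<in> I"
proof
  note cl = ideal_poly_ring_closed[OF assms]
  show "f - g \<in> I" if "I +>\<^bsub>poly_ring A\<^esub> f = I +>\<^bsub>poly_ring A\<^esub> g"
    using that cl(2) mem_coset_iff[of f A I f] mem_coset_iff[of f A I g] by auto
  assume *: "f - g \<in> I"
  have "h - f \<in> I \<longleftrightarrow> h - g \<in> I" for h
    using cl(3)[OF _ *, of "h - f"] cl(7)[OF _ *, of "h - g"] by auto
  then show "I +>\<^bsub>poly_ring A\<^esub> f = I +>\<^bsub>poly_ring A\<^esub> g"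
    by (auto simp: mem_coset_iff)
qed

lemma quotient_add:
  assumes "ideal I (poly_ring A)" "f \<in> carrier (poly_ring A)" "g \<in> carrier (poly_ring A)"
  shows "(I +>\<^bsub>poly_ring A\<^esub> f) \<oplus>\<^bsub>poly_ring A Quot I\<^esub> (I +>\<^bsub>poly_ring A\<^esub> g) =
      I +>\<^bsub>poly_ring A\<^esub> (f + g)"
  using ring_hom_add[OF ideal.rcos_ring_hom[OF assms(1)] assms(2,3)] by simp

lemma quotient_mult:
  assumes "ideal I (poly_ring A)" "f \<in> carrier (poly_ring A)" "g \<in> carrier (poly_ring A)"
  shows "(I +>\<^bsub>poly_ring A\<^esub> f) \<otimes>\<^bsub>poly_ring A Quot I\<^esub> (I +>\<^bsub>poly_ring A\<^esub> g) =
      I +>\<^bsub>poly_ring A\<^esub> (f * g)"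
  using ring_hom_mult[OF ideal.rcos_ring_hom[OF assms(1)] assms(2,3)] by simp

text \<open>
  The least degree in a class is attained, so the classes of degree at most \<open>j\<close> are those of
  polynomials of degree at most \<open>j\<close>.
\<close>

lemma classes_up_to_eq:
  assumes I: "ideal I (poly_ring A)"
  shows "classes_up_to A I j =
      {I +>\<^bsub>poly_ring A\<^esub> f | f. f \<in> carrier (poly_ring A) \<and> total_deg f \<le> j}"
proof (intro equalityI subsetI)
  fix F assume F: "F \<in> classes_up_to A I j"
  then obtain f where f: "f \<in> carrier (poly_ring A)" "F = I +>\<^bsub>poly_ring A\<^esub> f"
    by (auto simp: classes_up_to_def FactRing_def A_RCOSETS_def')
  have "f \<in> F" using ideal_poly_ring_zero[OF I] by (simp add: f mem_coset_iff)
  then have "\<exists>h\<in>F. total_deg h = class_deg F"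
    unfolding class_deg_def by (intro LeastI[of "\<lambda>j. \<exists>h\<in>F. total_deg h = j"]) blast
  then obtain h where h: "h \<in> F" "total_deg h = class_deg F" by blast
  have hf: "h - f \<in> I" using h f by (simp add: mem_coset_iff)
  have "h \<in> carrier (poly_ring A)"
    using poly_ring_add[OF ideal_poly_ring_carrier[OF I hf] f(1)] by simp
  moreover have "F = I +>\<^bsub>poly_ring A\<^esub> h"
    using coset_eq_iff[OF I] hf f(2) by metis
  moreover have "total_deg h \<le> j" using h F by (simp add: classes_up_to_def)
  ultimately show "F \<in> {I +>\<^bsub>poly_ring A\<^esub> f | f. f \<in> carrier (poly_ring A) \<and> total_deg f \<le> j}"
      by blast
next
  fix F assume "F \<in> {I +>\<^bsub>poly_ring A\<^esub> f | f. f \<in> carrier (poly_ring A) \<and> total_deg f \<le> j}"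
  then obtain f where f: "f \<in> carrier (poly_ring A)" "F = I +>\<^bsub>poly_ring A\<^esub> f" "total_deg f \<le> j"
      by blast
  have "f \<in> F" using ideal_poly_ring_zero[OF I] by (simp add: f mem_coset_iff)
  then have "class_deg F \<le> total_deg f" unfolding class_deg_def by (intro Least_le) blast
  then show "F \<in> classes_up_to A I j"
    using f by (auto simp: classes_up_to_def FactRing_def A_RCOSETS_def')
qed

section \<open>Theta bodies through pseudo-expectations\<close>

text \<open>
  A linear functional on classes is the same as one on polynomials of degree at most \<open>2 * k\<close> that
  is zero on the members of the ideal of that degree. This form avoids cosets in everything that
  follows.
\<close>

definition pseudo_expectation :: "'a set \<Rightarrow> 'a mpoly set \<Rightarrow> nat \<Rightarrow> ('a mpoly \<Rightarrow> real) \<Rightarrow> bool" where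
  "pseudo_expectation A I k L \<longleftrightarrow>
    (\<forall>f\<in>carrier (poly_ring A). \<forall>g\<in>carrier (poly_ring A).
       total_deg f \<le> 2 * k \<longrightarrow> total_deg g \<le> 2 * k \<longrightarrow> L (f + g) = L f + L g) \<and>
    (\<forall>c. \<forall>f\<in>carrier (poly_ring A). total_deg f \<le> 2 * k \<longrightarrow> L (c *\<^sub>R f) = c * L f) \<and>
    (\<forall>f\<in>I. total_deg f \<le> 2 * k \<longrightarrow> L f = 0) \<and>
    (\<forall>h\<in>carrier (poly_ring A). total_deg h \<le> k \<longrightarrow> 0 \<le> L (h ^ 2)) \<and>
    L 1 = 1"

lemma pseudo_expectationD:
  assumes "pseudo_expectation A I k L"
  shows "\<And>f g. \<lbrakk>f \<in> carrier (poly_ring A); g \<in> carrier (poly_ring A); total_deg f \<le> 2 * k;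
      total_deg g \<le> 2 * k\<rbrakk>
      \<Longrightarrow> L (f + g) = L f + L g"
    and "\<And>c f. \<lbrakk>f \<in> carrier (poly_ring A); total_deg f \<le> 2 * k\<rbrakk> \<Longrightarrow> L (c *\<^sub>R f) = c * L f"
    and "\<And>f. \<lbrakk>f \<in> I; total_deg f \<le> 2 * k\<rbrakk> \<Longrightarrow> L f = 0"
    and "\<And>h. \<lbrakk>h \<in> carrier (poly_ring A); total_deg h \<le> k\<rbrakk> \<Longrightarrow> 0 \<le> L (h ^ 2)"
    and "L 1 = 1"
  using assms by (auto simp: pseudo_expectation_def)

lemma pseudo_expectation_sum:
  assumes L: "pseudo_expectation A I k L"
    and "\<And>i. i \<in> S \<Longrightarrow> f i \<in> carrier (poly_ring A)" "\<And>i. i \<in> S \<Longrightarrow> total_deg (f i) \<le> 2 * k"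
  shows "L (\<Sum>i\<in>S. f i) = (\<Sum>i\<in>S. L (f i))"
proof -
  have "L 0 = 0" using pseudo_expectationD(2)[OF L poly_ring_zero, of 0] by simp
  then show ?thesis
    using assms(2,3)
    by (induction S rule: infinite_finite_induct)
       (auto simp: pseudo_expectationD(1)[OF L] poly_ring_sum total_deg_sum_le)
qed

lemma total_deg_square_le: "total_deg h \<le> k \<Longrightarrow> total_deg (h ^ 2) \<le> 2 * k"
  using total_deg_power_le[of h k 2] by simp

lemma pseudo_expectation_of_sos_dual:
  assumes I: "ideal I (poly_ring A)" and l: "l \<in> sos_dual A I k" "l (I +>\<^bsub>poly_ring A\<^esub> 1) = 1"
  shows "pseudo_expectation A I k (\<lambda>f. l (I +>\<^bsub>poly_ring A\<^esub> f))"
proof -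
  have cl: "I +>\<^bsub>poly_ring A\<^esub> f \<in> classes_up_to A I (2 * k)"
    if "f \<in> carrier (poly_ring A)" "total_deg f \<le> 2 * k" for f
    using that by (auto simp: classes_up_to_eq[OF I])
  have add: "l (I +>\<^bsub>poly_ring A\<^esub> (f + g)) = l (I +>\<^bsub>poly_ring A\<^esub> f) + l (I +>\<^bsub>poly_ring A\<^esub> g)"
    if "f \<in> carrier (poly_ring A)" "g \<in> carrier (poly_ring A)" "total_deg f \<le> 2 * k"
        "total_deg g \<le> 2 * k" for f g
    using l(1) cl[OF that(1,3)] cl[OF that(2,4)]
    by (simp add: sos_dual_def linear_functionals_def quotient_add[OF I that(1,2), symmetric])
  have scale: "l (I +>\<^bsub>poly_ring A\<^esub> (c *\<^sub>R f)) = c * l (I +>\<^bsub>poly_ring A\<^esub> f)"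
    if "f \<in> carrier (poly_ring A)" "total_deg f \<le> 2 * k" for c f
    using l(1) cl[OF that]
    by (simp add: sos_dual_def linear_functionals_def const_mult[symmetric]
        quotient_mult[OF I poly_ring_const that(1), symmetric])
  have zero: "l (I +>\<^bsub>poly_ring A\<^esub> f) = 0" if "f \<in> I" "total_deg f \<le> 2 * k" for f
  proof -
    have "I +>\<^bsub>poly_ring A\<^esub> f = I +>\<^bsub>poly_ring A\<^esub> 0"
      using that by (simp add: coset_eq_iff[OF I])
    then show ?thesis using scale[of 0 0] by (simp add: poly_ring_zero)
  qed
  have pos: "0 \<le> l (I +>\<^bsub>poly_ring A\<^esub> h ^ 2)" if "h \<in> carrier (poly_ring A)" "total_deg h \<le> k" for h
  proof -
    have "I +>\<^bsub>poly_ring A\<^esub> h ^ 2 \<in> sos_classes A I k"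
      unfolding sos_classes_def using that by (intro CollectI exI[of _ "[h]"]) auto
    then show ?thesis using l(1) by (simp add: sos_dual_def)
  qed
  show ?thesis
    unfolding pseudo_expectation_def using add scale zero pos l(2) by blast
qed

text \<open>
  A pseudo-expectation gives a functional on classes by evaluating it at any representative of low
  degree; two of these differ by a member of the ideal of degree at most \<open>2 * k\<close>, on which it is
  zero.
\<close>

lemma sos_dual_of_pseudo_expectation:
  assumes I: "ideal I (poly_ring A)" and L: "pseudo_expectation A I k L"
  obtains l where "l \<in> sos_dual A I k"
    and "\<And>f. \<lbrakk>f \<in> carrier (poly_ring A); total_deg f \<le> 2 * k\<rbrakk> \<Longrightarrow> l (I +>\<^bsub>poly_ring A\<^esub> f) = L f"
proof -
  note D = pseudo_expectationD[OF L]
  \<comment> \<open>any representative of degree at most \<open>2 * k\<close> may be chosen\<close>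
  define l where "l F = L (SOME f. f \<in> F \<and> f \<in> carrier (poly_ring A) \<and> total_deg f \<le> 2 * k)" for F
  have l: "l (I +>\<^bsub>poly_ring A\<^esub> f) = L f" if f: "f \<in> carrier (poly_ring A)" "total_deg f \<le> 2 * k"
      for f
  proof -
    define g where "g = (SOME g. g \<in> I +>\<^bsub>poly_ring A\<^esub> f \<and> g \<in> carrier (poly_ring A) \<and>
        total_deg g \<le> 2 * k)"
    have "g \<in> I +>\<^bsub>poly_ring A\<^esub> f \<and> g \<in> carrier (poly_ring A) \<and> total_deg g \<le> 2 * k"
      unfolding g_def by (rule someI[of _ f])
          (use f ideal_poly_ring_zero[OF I] in \<open>auto simp: mem_coset_iff\<close>)
    then have g: "g - f \<in> I" "total_deg (g - f) \<le> 2 * k"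
      using f by (auto simp: mem_coset_iff intro: total_deg_diff_le)
    have "L g = L ((g - f) + f)" by simp
    also have "\<dots> = L (g - f) + L f"
      using f g ideal_poly_ring_carrier[OF I g(1)] by (intro D(1)) auto
    also have "L (g - f) = 0" using g by (rule D(3))
    finally show ?thesis by (simp add: l_def g_def)
  qed
  have "l \<in> sos_dual A I k"
    unfolding sos_dual_def linear_functionals_def
  proof (intro CollectI conjI ballI allI)
    fix F G assume "F \<in> classes_up_to A I (2 * k)" "G \<in> classes_up_to A I (2 * k)"
    then obtain f g where "f \<in> carrier (poly_ring A)" "total_deg f \<le> 2 * k"
        "F = I +>\<^bsub>poly_ring A\<^esub> f"
      "g \<in> carrier (poly_ring A)" "total_deg g \<le> 2 * k" "G = I +>\<^bsub>poly_ring A\<^esub> g"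
      by (auto simp: classes_up_to_eq[OF I])
    then show "l (F \<oplus>\<^bsub>poly_ring A Quot I\<^esub> G) = l F + l G"
      by (simp add: quotient_add[OF I] l poly_ring_add total_deg_add_le D(1))
  next
    fix c F assume "F \<in> classes_up_to A I (2 * k)"
    then obtain f where "f \<in> carrier (poly_ring A)" "total_deg f \<le> 2 * k" "F = I +>\<^bsub>poly_ring A\<^esub> f"
      by (auto simp: classes_up_to_eq[OF I])
    then show "l ((I +>\<^bsub>poly_ring A\<^esub> const c) \<otimes>\<^bsub>poly_ring A Quot I\<^esub> F) = c * l F"
      by (simp add: quotient_mult[OF I poly_ring_const] const_mult l poly_ring_scaleR
          total_deg_scaleR_le D(2))
  next
    fix F assume "F \<in> sos_classes A I k"
    then obtain hs where hs: "F = I +>\<^bsub>poly_ring A\<^esub> (\<Sum>h\<leftarrow>hs. h ^ 2)"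
      "\<forall>h\<in>set hs. h \<in> carrier (poly_ring A) \<and> total_deg h \<le> k"
      by (auto simp: sos_classes_def)
    have "(\<Sum>h\<leftarrow>hs. h ^ 2) \<in> carrier (poly_ring A) \<and> total_deg (\<Sum>h\<leftarrow>hs. h ^ 2) \<le> 2 * k \<and>
        0 \<le> L (\<Sum>h\<leftarrow>hs. h ^ 2)"
      using hs(2)
    proof (induction hs)
      case Nil
      then show ?case using D(2)[OF poly_ring_zero, of 0] by (simp add: poly_ring_zero)
    next
      case (Cons h hs)
      let ?s = "\<Sum>h\<leftarrow>hs. h ^ 2"
      have s: "?s \<in> carrier (poly_ring A)" "total_deg ?s \<le> 2 * k" "0 \<le> L ?s"
        using Cons by auto
      have h: "h \<in> carrier (poly_ring A)" "h ^ 2 \<in> carrier (poly_ring A)" "total_deg h \<le> k"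
          "total_deg (h ^ 2) \<le> 2 * k"
        using Cons.prems by (auto intro: poly_ring_power total_deg_square_le)
      have "L (h ^ 2 + ?s) = L (h ^ 2) + L ?s"
        by (intro D(1) s h)
      then show ?case
        using s h D(4)[of h] by (simp add: poly_ring_add total_deg_add_le)
    qed
    then show "0 \<le> l F" by (simp add: hs(1) l)
  qed
  then show ?thesis using l that by blast
qed

lemma theta_body_eq_pseudo_expectation:
  assumes I: "ideal I (poly_ring A)" and k: "k \<ge> 1"
  shows "theta_body A I k = closure {of_entries A (\<lambda>a. L (var a)) | L. pseudo_expectation A I k L}"
proof -
  have "{of_entries A (\<lambda>a. l (I +>\<^bsub>poly_ring A\<^esub> var a)) | l. l \<in> sos_dual A I k \<and>
      l (I +>\<^bsub>poly_ring A\<^esub> 1) = 1}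
      = {of_entries A (\<lambda>a. L (var a)) | L. pseudo_expectation A I k L}" (is "?S = ?T")
  proof (intro equalityI subsetI)
    fix x assume "x \<in> ?S"
    then obtain l where "l \<in> sos_dual A I k" "l (I +>\<^bsub>poly_ring A\<^esub> 1) = 1"
      "x = of_entries A (\<lambda>a. l (I +>\<^bsub>poly_ring A\<^esub> var a))" by blast
    then show "x \<in> ?T"
      using pseudo_expectation_of_sos_dual[OF I]
      by (intro CollectI exI[of _ "\<lambda>f. l (I +>\<^bsub>poly_ring A\<^esub> f)"]) auto
  next
    fix x assume "x \<in> ?T"
    then obtain L where L: "pseudo_expectation A I k L" "x = of_entries A (\<lambda>a. L (var a))" by blast
    obtain l where l: "l \<in> sos_dual A I k"
      "\<And>f. \<lbrakk>f \<in> carrier (poly_ring A); total_deg f \<le> 2 * k\<rbrakk> \<Longrightarrow> l (I +>\<^bsub>poly_ring A\<^esub> f) = L f"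
      using sos_dual_of_pseudo_expectation[OF I L(1)] by blast
    have "l (I +>\<^bsub>poly_ring A\<^esub> var a) = L (var a)" if "a \<in> A" for a
      using total_deg_var_le[of a] k that by (intro l(2)) (auto simp: poly_ring_var)
    then have "x = of_entries A (\<lambda>a. l (I +>\<^bsub>poly_ring A\<^esub> var a))"
      by (simp add: L(2) of_entries_def)
    moreover have "l (I +>\<^bsub>poly_ring A\<^esub> 1) = 1"
      using l(2)[OF poly_ring_one] pseudo_expectationD(5)[OF L(1)] by simp
    ultimately show "x \<in> ?S" using l(1) by blast
  qed
  then show ?thesis by (simp add: theta_body_def)
qed

text \<open>
  The mechanism behind the symmetry: linear substitutions that preserve the ideal act on
  pseudo-expectations.
\<close>

lemma pseudo_expectation_compose:
  assumes L: "pseudo_expectation A I k L"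
    and \<sigma>: "\<And>a. a \<in> A \<Longrightarrow> \<sigma> a \<in> carrier (poly_ring A)" "\<And>a. a \<in> A \<Longrightarrow> total_deg (\<sigma> a) \<le> 1"
    and I: "ideal I (poly_ring A)" "\<And>f. f \<in> I \<Longrightarrow> poly_hom \<sigma> f \<in> I"
  shows "pseudo_expectation A I k (\<lambda>f. L (poly_hom \<sigma> f))"
proof -
  note D = pseudo_expectationD[OF L]
  have cl: "poly_hom \<sigma> f \<in> carrier (poly_ring A)" if "f \<in> carrier (poly_ring A)" for f
    using that by (rule poly_hom_closed) (rule \<sigma>(1))
  have deg: "total_deg (poly_hom \<sigma> f) \<le> j" if "f \<in> carrier (poly_ring A)" "total_deg f \<le> j" for f j
    using that by (rule total_deg_poly_hom_le) (rule \<sigma>(2))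
  show ?thesis
    unfolding pseudo_expectation_def poly_hom_simps poly_hom_one
    using D(5) I(2) ideal_poly_ring_carrier[OF I(1)]
    by (intro conjI ballI allI impI D(1-4) cl deg) blast+
qed

text \<open>
  A real zero of the ideal is a pseudo-expectation, so the theta body contains the zeros of its
  ideal.
\<close>

lemma pseudo_expectation_eval:
  assumes "\<And>f. f \<in> I \<Longrightarrow> poly_hom x f = 0"
  shows "pseudo_expectation A I k (poly_hom x)"
  using assms by (auto simp: pseudo_expectation_def poly_hom_simps)

lemma pseudo_expectation_convex:
  assumes L: "pseudo_expectation A I k L" "pseudo_expectation A I k M"
    and "0 \<le> u" "0 \<le> v" "u + v = 1"
  shows "pseudo_expectation A I k (\<lambda>f. u * L f + v * M f)"
  unfolding pseudo_expectation_def
  using pseudo_expectationD[OF L(1)] pseudo_expectationD[OF L(2)] assms(3-)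
  by (auto simp: algebra_simps)

text \<open>
  If the sum of the squares of the variables is the constant \<open>c\<close> modulo the ideal, then \<open>L\<close> takes
  a value of at most \<open>c\<close> on the square of each variable. The first moment is then controlled by \<open>\<plusminus>
  2 * L (X\<^sub>a) \<le> L (X\<^sub>a\<^sup>2) + 1\<close>.
\<close>

lemma pseudo_expectation_bound:
  assumes L: "pseudo_expectation A I k L" and k: "k \<ge> 1"
    and A: "finite A" "a \<in> A" and sphere: "(\<Sum>b\<in>A. var b ^ 2) - const c \<in> I"
  shows "\<bar>L (var a)\<bar> \<le> (1 + c) / 2"
proof -
  note D = pseudo_expectationD[OF L]
  have v: "var b \<in> carrier (poly_ring A)" "total_deg (var b) \<le> k" "total_deg (var b) \<le> 2 * k"
     "total_deg (var b ^ 2) \<le> 2 * k" if "b \<in> A" for b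
    using total_deg_var_le[of b] k that total_deg_square_le[of "var b" k]
        by (auto simp: poly_ring_var)
  have c: "L (const c) = c" for c
    using D(2)[OF poly_ring_one, of c] D(5) by (simp add: scaleR_one_mpoly)
  have "L (\<Sum>b\<in>A. var b ^ 2) = L (((\<Sum>b\<in>A. var b ^ 2) - const c) + const c)" by simp
  also have "\<dots> = L ((\<Sum>b\<in>A. var b ^ 2) - const c) + L (const c)"
    by (rule D(1)) (auto intro!: poly_ring_closed v total_deg_diff_le total_deg_sum_le)
  also have "\<dots> = c"
    using sphere v by (simp add: c D(3) total_deg_diff_le total_deg_sum_le)
  also have "L (\<Sum>b\<in>A. var b ^ 2) = (\<Sum>b\<in>A. L (var b ^ 2))"
    using v by (intro pseudo_expectation_sum[OF L]) (auto intro: poly_ring_power)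
  finally have sum: "(\<Sum>b\<in>A. L (var b ^ 2)) = c" .
  have "L (var a ^ 2) \<le> (\<Sum>b\<in>A. L (var b ^ 2))"
    using A D(4)[OF v(1,2)] by (intro member_le_sum) auto
  then have le: "L (var a ^ 2) \<le> c" using sum by simp
  \<comment> \<open>from the square of \<open>X\<^sub>a + t\<close>, used below with both signs of \<open>t\<close>\<close>
  have "0 \<le> L (var a ^ 2) + 2 * t * L (var a) + 1" if "t ^ 2 = 1" for t
  proof -
    have "(var a + const t) ^ 2 = var a ^ 2 + ((2 * t) *\<^sub>R var a + const 1)"
    proof -
      have c2: "const (2 * t) = 2 * const t" by (simp only: const_def single_add mult_2)
      have ct: "const t * const t = 1"
        using that by (simp add: const_def mult_single power2_eq_square)
      show ?thesis
        unfolding const_mult[symmetric] c2 power2_eq_square const_1 ct[symmetric]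
        by (simp add: algebra_simps)
    qed
    moreover have "0 \<le> L ((var a + const t) ^ 2)"
      using v A by (intro D(4) poly_ring_closed total_deg_add_le) auto
    moreover have "L (var a ^ 2 + ((2 * t) *\<^sub>R var a + const 1)) =
        L (var a ^ 2) + (2 * t * L (var a) + 1)"
      using v A D(5)
      by (simp add: D(1) D(2) poly_ring_closed total_deg_add_le total_deg_scaleR_le)
    ultimately show ?thesis by simp
  qed
  from this[of 1] this[of "-1"] le show ?thesis by (simp add: abs_le_iff)
qed

lemma lookup_of_entries:
  "finite A \<Longrightarrow> Poly_Mapping.lookup (of_entries A f) a = (if a \<in> A then f a else 0)"
  by (simp add: of_entries_def lookup_sum lookup_single when_def sum.delta')

section \<open>Finite-dimensional spaces of tensors\<close>

lemma bounded_linear_lookup: "bounded_linear (\<lambda>x :: 'a \<Rightarrow>\<^sub>0 real. Poly_Mapping.lookup x a)"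
proof (rule bounded_linear_intro[of _ 1])
  fix x :: "'a \<Rightarrow>\<^sub>0 real"
  have "norm x = (\<Sum>b\<in>Poly_Mapping.keys x. \<bar>Poly_Mapping.lookup x b\<bar>)"
    by (simp add: norm_poly_mapping_def dist_poly_mapping_def)
  moreover have "\<bar>Poly_Mapping.lookup x a\<bar> \<le> (\<Sum>b\<in>Poly_Mapping.keys x. \<bar>Poly_Mapping.lookup x b\<bar>)"
    by (cases "a \<in> Poly_Mapping.keys x") (auto intro: member_le_sum sum_nonneg simp: in_keys_iff)
  ultimately show "norm (Poly_Mapping.lookup x a) \<le> norm x * 1" by simp
qed (simp_all add: lookup_add)

lemma vec_space_iff: "x \<in> vec_space A \<longleftrightarrow> (\<forall>a. a \<notin> A \<longrightarrow> Poly_Mapping.lookup x a = 0)"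
  by (auto simp: vec_space_def in_keys_iff)

lemma subspace_vec_space: "subspace (vec_space A :: ('a \<Rightarrow>\<^sub>0 real) set)"
  by (auto simp: subspace_def vec_space_iff lookup_add)

lemma closed_vec_space: "closed (vec_space A :: ('a \<Rightarrow>\<^sub>0 real) set)"
proof -
  have "vec_space A = (\<Inter>a\<in>- A. {x :: 'a \<Rightarrow>\<^sub>0 real. Poly_Mapping.lookup x a = 0})"
    by (auto simp: vec_space_iff)
  also have "closed \<dots>"
    by (intro closed_INT ballI closed_Collect_eq continuous_intros
        linear_continuous_on bounded_linear_lookup)
  finally show ?thesis .
qed

lemma norm_vec_space:
  assumes "finite A" "x \<in> vec_space A"
  shows "norm (x :: 'a \<Rightarrow>\<^sub>0 real) = (\<Sum>a\<in>A. \<bar>Poly_Mapping.lookup x a\<bar>)"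
proof -
  have "norm x = (\<Sum>b\<in>Poly_Mapping.keys x. \<bar>Poly_Mapping.lookup x b\<bar>)"
    by (simp add: norm_poly_mapping_def dist_poly_mapping_def)
  also have "\<dots> = (\<Sum>a\<in>A. \<bar>Poly_Mapping.lookup x a\<bar>)"
    using assms by (intro sum.mono_neutral_left) (auto simp: vec_space_def in_keys_iff)
  finally show ?thesis .
qed

lemma vec_space_eqI:
  assumes "x \<in> vec_space A" "y \<in> vec_space A"
      "\<And>a. a \<in> A \<Longrightarrow> Poly_Mapping.lookup x a = Poly_Mapping.lookup y a"
  shows "x = y"
  using assms by (intro poly_mapping_eqI) (metis vec_space_iff)

lemma single_in_vec_space: "a \<in> A \<Longrightarrow> Poly_Mapping.single a c \<in> vec_space A"
  by (auto simp: vec_space_def)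

lemma of_entries_in_vec_space: "finite A \<Longrightarrow> of_entries A f \<in> vec_space A"
  by (simp add: vec_space_iff lookup_of_entries)

lemma of_entries_lookup: "finite A \<Longrightarrow> x \<in> vec_space A \<Longrightarrow> of_entries A (Poly_Mapping.lookup x) = x"
  by (rule vec_space_eqI[of _ A]) (auto simp: of_entries_in_vec_space lookup_of_entries)

lemma vec_space_expansion:
  assumes "finite A" "x \<in> vec_space A"
  shows "x = (\<Sum>a\<in>A. Poly_Mapping.lookup x a *\<^sub>R Poly_Mapping.single a 1)"
  using assms
  by (intro vec_space_eqI[of _ A])
     (auto simp: lookup_sum lookup_single when_def if_distrib sum.delta' intro!:
         subspace_sum[OF subspace_vec_space]
        subspace_scale[OF subspace_vec_space] single_in_vec_space cong: if_cong)

section \<open>Norms with a prescribed unit ball\<close>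

text \<open>
  The norm is the Minkowski gauge \<open>N x = inf {t > 0. x / t \<in> C}\<close>. Convexity gives the triangle
  inequality, symmetry the homogeneity for negative scalars, the inner ball finiteness,
  boundedness definiteness, and closedness that \<open>N x \<le> 1\<close> already puts \<open>x\<close> into \<open>C\<close>.
\<close>

lemma norm_on_of_unit_ball:
  fixes S C :: "'v::real_normed_vector set"
  assumes S: "subspace S" and CS: "C \<subseteq> S" and "closed C" and "convex C"
    and neg: "\<And>x. x \<in> C \<Longrightarrow> - x \<in> C"
    and r: "r > 0" "\<And>x. \<lbrakk>x \<in> S; norm x \<le> r\<rbrakk> \<Longrightarrow> x \<in> C"
    and R: "\<And>x. x \<in> C \<Longrightarrow> norm x \<le> R"
  shows "\<exists>N. norm_on S N \<and> C = {x \<in> S. N x \<le> 1}"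
proof -
  define T where "T x = {t. t > 0 \<and> (1 / t) *\<^sub>R x \<in> C}" for x
  define N where "N x = Inf (T x)" for x
  have zero: "0 \<in> C" using r subspace_0[OF S] by simp
  have ne: "T x \<noteq> {}" if "x \<in> S" for x
  proof -
    define t where "t = norm x / r + 1"
    have t: "t > 0" using r(1) by (simp add: t_def add_nonneg_pos)
    have "norm x \<le> r * t" using r(1) by (simp add: t_def field_simps)
    then have "norm ((1 / t) *\<^sub>R x) \<le> r" using t by (simp add: field_simps)
    then have "(1 / t) *\<^sub>R x \<in> C" using r(2) subspace_scale[OF S that] by blast
    then show ?thesis using t by (auto simp: T_def)
  qed
  have bdd: "bdd_below (T x)" for x by (rule bdd_belowI[of _ 0]) (auto simp: T_def)
  have N_le: "N x \<le> t" if "t \<in> T x" for x t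
    unfolding N_def using that bdd by (rule cInf_lower)
  have N_nonneg: "0 \<le> N x" if "x \<in> S" for x
    unfolding N_def using ne[OF that] by (rule cInf_greatest) (auto simp: T_def)
  have up: "s \<in> T x" if "t \<in> T x" "t \<le> s" for s t x
  proof -
    have t: "t > 0" "s > 0" "(1 / t) *\<^sub>R x \<in> C" using that by (auto simp: T_def)
    have "(1 - t / s) *\<^sub>R 0 + (t / s) *\<^sub>R ((1 / t) *\<^sub>R x) \<in> C"
      using t that(2) by (intro convexD_alt[OF \<open>convex C\<close>] zero) auto
    then show ?thesis using t by (simp add: T_def)
  qed
  have lt: "s \<in> T x" if x: "x \<in> S" "N x < s" for s x
  proof -
    obtain t where "t \<in> T x" "t < s"
      using cInf_lessD[OF ne[OF x(1)]] x(2) by (auto simp: N_def)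
    then show ?thesis using up by simp
  qed
  have ball: "C = {x \<in> S. N x \<le> 1}"
  proof (intro equalityI subsetI)
    fix x assume "x \<in> C"
    then have "1 \<in> T x" by (simp add: T_def)
    then show "x \<in> {x \<in> S. N x \<le> 1}" using N_le CS \<open>x \<in> C\<close> by auto
  next
    fix x assume "x \<in> {x \<in> S. N x \<le> 1}"
    then have x: "x \<in> S" "N x \<le> 1" by auto
    \<comment> \<open>\<open>N x \<le> 1\<close> only gives \<open>x / t \<in> C\<close> for \<open>t > 1\<close>; the case \<open>t = 1\<close> is a limit\<close>
    have "(1 / (1 + 1 / real (Suc n))) *\<^sub>R x \<in> C" for n
    proof -
      have "N x < 1 + 1 / real (Suc n)" using x(2) by (rule order.strict_trans1) simp
      then show ?thesis using lt[OF x(1)] by (simp only: T_def mem_Collect_eq)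
    qed
    moreover have "(\<lambda>n. (1 / (1 + 1 / real (Suc n))) *\<^sub>R x) \<longlonglongrightarrow> (1 / (1 + 0)) *\<^sub>R x"
      by (intro tendsto_intros LIMSEQ_Suc[OF lim_1_over_n]) auto
    ultimately have "(1 / (1 + 0)) *\<^sub>R x \<in> C"
      using \<open>closed C\<close> by (meson closed_sequentially)
    then show "x \<in> C" by simp
  qed
  have N0: "N 0 = 0"
  proof (rule antisym)
    show "N 0 \<le> 0"
      by (rule field_le_epsilon) (auto intro!: N_le simp: T_def zero)
  qed (rule N_nonneg[OF subspace_0[OF S]])
  have N_scale_le: "N (c *\<^sub>R x) \<le> \<bar>c\<bar> * N x" if x: "x \<in> S" and "c \<noteq> 0" for c x
  proof -
    have "\<bar>c\<bar> * t \<in> T (c *\<^sub>R x)" if "t \<in> T x" for t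
    proof -
      have "(1 / (\<bar>c\<bar> * t)) *\<^sub>R c *\<^sub>R x = sgn c *\<^sub>R (1 / t) *\<^sub>R x"
        using \<open>c \<noteq> 0\<close> by (simp add: sgn_if abs_if)
      moreover have "sgn c *\<^sub>R (1 / t) *\<^sub>R x \<in> C"
        using that neg[of "(1 / t) *\<^sub>R x"] \<open>c \<noteq> 0\<close> by (auto simp: T_def sgn_if)
      ultimately have "(1 / (\<bar>c\<bar> * t)) *\<^sub>R c *\<^sub>R x \<in> C" by (simp only:)
      then show ?thesis using that \<open>c \<noteq> 0\<close> unfolding T_def by (intro CollectI conjI) auto
    qed
    then have "N (c *\<^sub>R x) / \<bar>c\<bar> \<le> t" if "t \<in> T x" for t
      using N_le that \<open>c \<noteq> 0\<close> by (fastforce simp: field_simps)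
    then have "N (c *\<^sub>R x) / \<bar>c\<bar> \<le> N x"
      unfolding N_def[of x] by (intro cInf_greatest ne x)
    then show ?thesis using \<open>c \<noteq> 0\<close> by (simp add: field_simps)
  qed
  have N_scale: "N (c *\<^sub>R x) = \<bar>c\<bar> * N x" if "x \<in> S" for c x
  proof (cases "c = 0")
    case False
    have "N ((1 / c) *\<^sub>R c *\<^sub>R x) \<le> \<bar>1 / c\<bar> * N (c *\<^sub>R x)"
      using False subspace_scale[OF S that] by (intro N_scale_le) auto
    then have "\<bar>c\<bar> * N x \<le> N (c *\<^sub>R x)" using False by (simp add: field_simps)
    with N_scale_le[OF that False] show ?thesis by simp
  qed (simp add: N0)
  have N_definite: "x = 0" if "x \<in> S" "N x = 0" for x
  proof (rule ccontr)
    assume "x \<noteq> 0"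
    \<comment> \<open>scaled so that \<open>x / s\<close> has norm \<open>R + 1\<close>, which is impossible inside \<open>C\<close>\<close>
    define s where "s = norm x / (R + 1)"
    have "R \<ge> 0" using R[OF zero] by simp
    then have s: "s > 0" using \<open>x \<noteq> 0\<close> by (simp add: s_def)
    then have "s \<in> T x" using lt that by simp
    then have "norm ((1 / s) *\<^sub>R x) \<le> R" unfolding T_def by (blast intro: R)
    moreover have "norm ((1 / s) *\<^sub>R x) = R + 1"
      using \<open>x \<noteq> 0\<close> \<open>R \<ge> 0\<close> by (simp add: s_def)
    ultimately show False by simp
  qed
  have N_triangle: "N (x + y) \<le> N x + N y" if "x \<in> S" "y \<in> S" for x y
  proof (rule field_le_epsilon)
    fix e :: real assume e: "e > 0"
    define s t where "s = N x + e / 2" and "t = N y + e / 2"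
    have "s \<in> T x" "t \<in> T y" using e that by (auto intro!: lt simp: s_def t_def)
    then have st: "s > 0" "t > 0" "(1 / s) *\<^sub>R x \<in> C" "(1 / t) *\<^sub>R y \<in> C" by (auto simp: T_def)
    have "(s / (s + t)) *\<^sub>R (1 / s) *\<^sub>R x + (t / (s + t)) *\<^sub>R (1 / t) *\<^sub>R y \<in> C"
      using st by (intro convexD[OF \<open>convex C\<close>]) (auto simp: add_divide_distrib[symmetric])
    then have "s + t \<in> T (x + y)" using st by (simp add: T_def scaleR_add_right)
    then have "N (x + y) \<le> s + t" by (rule N_le)
    then show "N (x + y) \<le> N x + N y + e" by (simp add: s_def t_def)
  qed
  have "norm_on S N"
    unfolding norm_on_def using N_nonneg N_scale N_definite N0 N_triangle by blast
  then show ?thesis using ball by blast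
qed

section \<open>Convex hulls of subsets of a sphere\<close>

text \<open>
  The parallelogram identity for a convex combination. Its last term makes Euclidean spheres
  strictly convex.
\<close>

lemma square_sum_convex_combination:
  fixes x y :: "'a \<Rightarrow>\<^sub>0 real"
  shows "(\<Sum>a\<in>A. (Poly_Mapping.lookup ((1 - u) *\<^sub>R x + u *\<^sub>R y) a)\<^sup>2) =
    (1 - u) * (\<Sum>a\<in>A. (Poly_Mapping.lookup x a)\<^sup>2) + u * (\<Sum>a\<in>A. (Poly_Mapping.lookup y a)\<^sup>2)
    - u * (1 - u) * (\<Sum>a\<in>A. (Poly_Mapping.lookup (x - y) a)\<^sup>2)"
  unfolding sum_distrib_left sum.distrib[symmetric] sum_subtractf[symmetric]
  by (rule sum.cong) (auto simp: lookup_add lookup_minus power2_eq_square algebra_simps)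

lemma convex_hull_subset_ball:
  assumes V: "V \<subseteq> vec_space A" "\<And>v. v \<in> V \<Longrightarrow> (\<Sum>a\<in>A. (Poly_Mapping.lookup v a)\<^sup>2) = (c::real)"
  shows "convex hull V \<subseteq> {x \<in> vec_space A. (\<Sum>a\<in>A. (Poly_Mapping.lookup x a)\<^sup>2) \<le> c}"
proof (rule hull_minimal)
  show "convex {x \<in> vec_space A. (\<Sum>a\<in>A. (Poly_Mapping.lookup x a)\<^sup>2) \<le> c}"
    unfolding convex_alt
  proof (intro ballI allI impI)
    fix x y u
    assume *: "x \<in> {x \<in> vec_space A. (\<Sum>a\<in>A. (Poly_Mapping.lookup x a)\<^sup>2) \<le> c}"
      "y \<in> {x \<in> vec_space A. (\<Sum>a\<in>A. (Poly_Mapping.lookup x a)\<^sup>2) \<le> c}"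
          and u: "0 \<le> u \<and> u \<le> (1::real)"
    have "(1 - u) * (\<Sum>a\<in>A. (Poly_Mapping.lookup x a)\<^sup>2) + u * (\<Sum>a\<in>A. (Poly_Mapping.lookup y a)\<^sup>2)
        \<le> (1 - u) * c + u * c"
      using * u by (intro add_mono mult_left_mono) auto
    moreover have "0 \<le> u * (1 - u) * (\<Sum>a\<in>A. (Poly_Mapping.lookup (x - y) a)\<^sup>2)"
      using u by (intro mult_nonneg_nonneg sum_nonneg) auto
    ultimately have "(\<Sum>a\<in>A. (Poly_Mapping.lookup ((1 - u) *\<^sub>R x + u *\<^sub>R y) a)\<^sup>2) \<le> c"
      unfolding square_sum_convex_combination by (simp add: algebra_simps)
    moreover have "(1 - u) *\<^sub>R x + u *\<^sub>R y \<in> vec_space A"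
      using * by (intro subspace_add subspace_scale subspace_vec_space) auto
    ultimately show "(1 - u) *\<^sub>R x + u *\<^sub>R y
        \<in> {x \<in> vec_space A. (\<Sum>a\<in>A. (Poly_Mapping.lookup x a)\<^sup>2) \<le> c}"
      by simp
  qed
qed (use V in auto)

text \<open>
  The hull lies in the Euclidean ball on whose boundary \<open>V\<close> lies, and a boundary point of that
  ball is not strictly between two different points of the ball.
\<close>

lemma extreme_point_of_sphere:
  assumes A: "finite A" and V: "V \<subseteq> vec_space A"
      "\<And>v. v \<in> V \<Longrightarrow> (\<Sum>a\<in>A. (Poly_Mapping.lookup v a)\<^sup>2) = (c::real)"
    and v: "v \<in> V"
  shows "v extreme_point_of (convex hull V)"
  unfolding extreme_point_of_def
proof (intro conjI ballI notI)
  show "v \<in> convex hull V" using v by (rule hull_inc)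
  fix x y assume xy: "x \<in> convex hull V" "y \<in> convex hull V" and "v \<in> open_segment x y"
  then obtain u where u: "x \<noteq> y" "0 < u" "u < 1" "v = (1 - u) *\<^sub>R x + u *\<^sub>R y"
    by (auto simp: in_segment)
  have xy': "x \<in> vec_space A" "(\<Sum>a\<in>A. (Poly_Mapping.lookup x a)\<^sup>2) \<le> c"
    "y \<in> vec_space A" "(\<Sum>a\<in>A. (Poly_Mapping.lookup y a)\<^sup>2) \<le> c"
    using convex_hull_subset_ball[OF V] xy by auto
  obtain a where "a \<in> A" "Poly_Mapping.lookup x a \<noteq> Poly_Mapping.lookup y a"
    using vec_space_eqI[OF xy'(1,3)] u(1) by blast
  then have "0 < (\<Sum>a\<in>A. (Poly_Mapping.lookup (x - y) a)\<^sup>2)"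
    using A by (intro sum_pos2[of _ a]) (auto simp: lookup_minus)
  then have pos: "0 < u * (1 - u) * (\<Sum>a\<in>A. (Poly_Mapping.lookup (x - y) a)\<^sup>2)"
    using u by simp
  have "c = (\<Sum>a\<in>A. (Poly_Mapping.lookup v a)\<^sup>2)" using V(2)[OF v] by simp
  also have "\<dots> < (1 - u) * (\<Sum>a\<in>A. (Poly_Mapping.lookup x a)\<^sup>2) + u *
      (\<Sum>a\<in>A. (Poly_Mapping.lookup y a)\<^sup>2)"
    using pos unfolding u(4) square_sum_convex_combination by simp
  also have "\<dots> \<le> (1 - u) * c + u * c"
    using xy' u by (intro add_mono mult_left_mono) auto
  also have "\<dots> = c" by (simp add: algebra_simps)
  finally show False by simp
qed

lemma automorphism_preserves_extreme_points:
  assumes g: "linear_automorphism_on S g" "g ` B = B" and S: "subspace S" "B \<subseteq> S"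
    and v: "v extreme_point_of B"
  shows "g v extreme_point_of B"
proof -
  have inj: "inj_on g S" and add: "\<And>x y. x \<in> S \<Longrightarrow> y \<in> S \<Longrightarrow> g (x + y) = g x + g y"
    and scale: "\<And>c x. x \<in> S \<Longrightarrow> g (c *\<^sub>R x) = c *\<^sub>R g x"
    using g(1) by (auto simp: linear_automorphism_on_def bij_betw_def)
  have vB: "v \<in> B" using v by (simp add: extreme_point_of_def)
  show ?thesis
    unfolding extreme_point_of_def
  proof (intro conjI ballI notI)
    show "g v \<in> B" using vB g(2) by blast
    fix x y assume "x \<in> B" "y \<in> B" and seg: "g v \<in> open_segment x y"
    then have "x \<in> g ` B" "y \<in> g ` B" by (simp_all add: g(2))
    then obtain x' y' where xy: "x' \<in> B" "x = g x'" "y' \<in> B" "y = g y'" by blast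
    obtain u where u: "x \<noteq> y" "0 < u" "u < 1" "g v = (1 - u) *\<^sub>R x + u *\<^sub>R y"
      using seg by (auto simp: in_segment)
    have mem: "x' \<in> S" "y' \<in> S" "v \<in> S" using xy vB S(2) by auto
    have "g v = g ((1 - u) *\<^sub>R x' + u *\<^sub>R y')"
      using mem by (simp add: u(4) xy add scale subspace_scale[OF S(1)])
    then have "v = (1 - u) *\<^sub>R x' + u *\<^sub>R y'"
      by (rule inj_onD[OF inj]) (intro mem subspace_add subspace_scale S(1))+
    then have "v \<in> open_segment x' y'" using u xy by (auto simp: in_segment)
    then show False using v xy by (auto simp: extreme_point_of_def)
  qed
qed

section \<open>Linear automorphisms in coordinates\<close>

lemma linear_automorphism_on_inv_into:
  assumes g: "linear_automorphism_on S g" and S: "subspace S"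
  shows "linear_automorphism_on S (inv_into S g)"
proof -
  have bij: "bij_betw g S S" and add: "\<And>x y. x \<in> S \<Longrightarrow> y \<in> S \<Longrightarrow> g (x + y) = g x + g y"
    and scale: "\<And>c x. x \<in> S \<Longrightarrow> g (c *\<^sub>R x) = c *\<^sub>R g x"
    using g by (auto simp: linear_automorphism_on_def)
  let ?h = "inv_into S g"
  have h: "?h x \<in> S" "g (?h x) = x" if "x \<in> S" for x
    using bij that by (auto simp: bij_betw_def inv_into_into f_inv_into_f)
  have hg: "?h (g x) = x" if "x \<in> S" for x
    using bij that by (simp add: bij_betw_def)
  show ?thesis
    unfolding linear_automorphism_on_def
  proof (intro conjI ballI allI)
    show "bij_betw ?h S S" by (rule bij_betw_inv_into[OF bij])
    show "?h (x + y) = ?h x + ?h y" if "x \<in> S" "y \<in> S" for x y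
      using hg[of "?h x + ?h y"] that h subspace_add[OF S] by (simp add: add)
    show "?h (c *\<^sub>R x) = c *\<^sub>R ?h x" if "x \<in> S" for c x
      using hg[of "c *\<^sub>R ?h x"] that h subspace_scale[OF S] by (simp add: scale)
  qed
qed

text \<open>
  A map that is linear on the subspace only is determined there by its values on the coordinate
  vectors; these values are the coefficients of the substitution attached to it.
\<close>

lemma linear_automorphism_on_expansion:
  assumes g: "linear_automorphism_on (vec_space A) g" and A: "finite A" and x: "x \<in> vec_space A"
  shows "g x = (\<Sum>a\<in>A. Poly_Mapping.lookup x a *\<^sub>R g (Poly_Mapping.single a (1::real)))"
proof -
  have add: "\<And>x y. x \<in> vec_space A \<Longrightarrow> y \<in> vec_space A \<Longrightarrow> g (x + y) = g x + g y"
    and scale: "\<And>c x. x \<in> vec_space A \<Longrightarrow> g (c *\<^sub>R x) = c *\<^sub>R g x"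
    using g by (auto simp: linear_automorphism_on_def)
  have "g 0 = 0" using scale[of 0 0] by (simp add: vec_space_iff)
  have sum: "g (\<Sum>b\<in>B. Poly_Mapping.lookup x b *\<^sub>R Poly_Mapping.single b 1) =
      (\<Sum>b\<in>B. Poly_Mapping.lookup x b *\<^sub>R g (Poly_Mapping.single b 1))" if "B \<subseteq> A" for B
    using finite_subset[OF that A] that \<open>g 0 = 0\<close>
  proof (induction B rule: finite_induct)
    case (insert b B)
    have "Poly_Mapping.lookup x b *\<^sub>R Poly_Mapping.single b 1 \<in> vec_space A"
      "(\<Sum>b\<in>B. Poly_Mapping.lookup x b *\<^sub>R Poly_Mapping.single b (1::real)) \<in> vec_space A"
      using insert.prems
      by (auto intro!: subspace_sum subspace_scale subspace_vec_space single_in_vec_space)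
    then show ?case using insert by (simp add: add scale single_in_vec_space)
  qed simp
  show ?thesis
    using sum[of A] vec_space_expansion[OF A x] by simp
qed

section \<open>Theta bodies of vanishing ideals\<close>

definition vanishing_ideal :: "'a set \<Rightarrow> ('a \<Rightarrow>\<^sub>0 real) set \<Rightarrow> 'a mpoly set" where
  "vanishing_ideal A V =
    {f \<in> carrier (poly_ring A). \<forall>x\<in>V. poly_hom (Poly_Mapping.lookup x) f = 0}"

lemma ideal_vanishing_ideal: "ideal (vanishing_ideal A V) (poly_ring A)"
proof (rule idealI)
  interpret cring "poly_ring A" by (rule cring_poly_ring)
  show "ring (poly_ring A)" by (rule ring_axioms)
  show "subgroup (vanishing_ideal A V) (add_monoid (poly_ring A))"
  proof (rule add.subgroupI)
    show "vanishing_ideal A V \<noteq> {}"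
      by (auto simp: vanishing_ideal_def intro!: exI[of _ 0] poly_ring_zero)
    fix f assume f: "f \<in> vanishing_ideal A V"
    have "\<ominus>\<^bsub>poly_ring A\<^esub> f = - f"
      using f by (intro minus_equality) (auto simp: vanishing_ideal_def poly_ring_uminus)
    then show "\<ominus>\<^bsub>poly_ring A\<^esub> f \<in> vanishing_ideal A V"
      using f by (simp add: vanishing_ideal_def poly_ring_uminus poly_hom_uminus)
  qed (auto simp: vanishing_ideal_def poly_hom_add poly_ring_add)
qed (auto simp: vanishing_ideal_def poly_hom_mult poly_ring_mult)

lemma theta_body_subset:
  assumes "finite A" "ideal I (poly_ring A)" "k \<ge> 1"
  shows "theta_body A I k \<subseteq> vec_space A"
  unfolding theta_body_eq_pseudo_expectation[OF assms(2,3)]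
  by (rule closure_minimal) (auto simp: closed_vec_space of_entries_in_vec_space assms(1))

text \<open>
  Extreme points go to extreme points, so \<open>g\<close> maps \<open>V\<close> into \<open>V\<close> and the substitution attached to
  \<open>g\<close> maps the vanishing ideal of \<open>V\<close> into itself. Hence it acts on pseudo-expectations, and
  through their first moments as \<open>g\<close>. Closures are respected because \<open>g\<close> is continuous.
\<close>

lemma theta_body_image_subset:
  assumes A: "finite A" and k: "k \<ge> 1"
    and V: "V \<subseteq> vec_space A" "\<And>v. v \<in> V \<Longrightarrow> (\<Sum>a\<in>A. (Poly_Mapping.lookup v a)\<^sup>2) = (c::real)"
    and g: "linear_automorphism_on (vec_space A) g" "g ` (convex hull V) = convex hull V"
  shows "g ` theta_body A (vanishing_ideal A V) k \<subseteq> theta_body A (vanishing_ideal A V) k"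
proof -
  let ?I = "vanishing_ideal A V"
  let ?T = "{of_entries A (\<lambda>a. L (var a)) | L. pseudo_expectation A ?I k L}"
  have gS: "g x \<in> vec_space A" if "x \<in> vec_space A" for x
    using g(1) that by (auto simp: linear_automorphism_on_def bij_betw_def)
  have gV: "g v \<in> V" if "v \<in> V" for v
    using automorphism_preserves_extreme_points[OF g subspace_vec_space _
        extreme_point_of_sphere[OF A V that]]
      convex_hull_subset_ball[OF V] extreme_point_of_convex_hull by blast
  \<comment> \<open>the substitution that sends each variable to the corresponding coordinate of \<open>g\<close>\<close>
  define \<sigma> where "\<sigma> a = (\<Sum>b\<in>A. Poly_Mapping.lookup (g (Poly_Mapping.single b 1)) a *\<^sub>R var b)" for a
  have gx: "Poly_Mapping.lookup (g x) a =
      (\<Sum>b\<in>A. Poly_Mapping.lookup x b * Poly_Mapping.lookup (g (Poly_Mapping.single b 1)) a)"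
    if "x \<in> vec_space A" for x a
    by (subst linear_automorphism_on_expansion[OF g(1) A that]) (simp add: lookup_sum)
  have \<sigma>: "\<sigma> a \<in> carrier (poly_ring A)" "total_deg (\<sigma> a) \<le> 1" for a
    unfolding \<sigma>_def
    by (auto intro!: poly_ring_sum poly_ring_scaleR poly_ring_var total_deg_sum_le
        total_deg_scaleR_le
        simp: total_deg_var_le[unfolded One_nat_def])
  have at_point: "poly_hom (Poly_Mapping.lookup x) (\<sigma> a) = Poly_Mapping.lookup (g x) a"
    if "x \<in> vec_space A" for x a
    by (simp add: \<sigma>_def poly_hom_simps gx[OF that] mult.commute)
  have \<sigma>I: "poly_hom \<sigma> f \<in> ?I" if f: "f \<in> ?I" for f
  proof -
    have "poly_hom \<sigma> f \<in> carrier (poly_ring A)"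
      using f \<sigma>(1) by (auto intro: poly_hom_closed simp: vanishing_ideal_def)
    moreover have "poly_hom (Poly_Mapping.lookup x) (poly_hom \<sigma> f) = 0" if "x \<in> V" for x
    proof -
      have "x \<in> vec_space A" using V(1) that by blast
      then show ?thesis
        using f gV[OF that] by (simp add: poly_hom_compose at_point vanishing_ideal_def)
    qed
    ultimately show ?thesis by (simp add: vanishing_ideal_def)
  qed
  have gT: "g x \<in> ?T" if "x \<in> ?T" for x
  proof -
    obtain L where L: "pseudo_expectation A ?I k L" "x = of_entries A (\<lambda>a. L (var a))"
      using \<open>x \<in> ?T\<close> by blast
    have L\<sigma>: "L (\<sigma> a) = (\<Sum>b\<in>A. Poly_Mapping.lookup (g (Poly_Mapping.single b 1)) a * L (var b))"
        for a
    proof -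
      have deg: "total_deg (var b) \<le> 2 * k" for b :: 'a
        using total_deg_var_le[of b] k by simp
      have "L (\<sigma> a) = (\<Sum>b\<in>A. L (Poly_Mapping.lookup (g (Poly_Mapping.single b 1)) a *\<^sub>R var b))"
        unfolding \<sigma>_def by (rule pseudo_expectation_sum[OF L(1)])
          (auto intro: poly_ring_scaleR poly_ring_var total_deg_scaleR_le deg)
      also have "\<dots> = (\<Sum>b\<in>A. Poly_Mapping.lookup (g (Poly_Mapping.single b 1)) a * L (var b))"
        by (intro sum.cong refl pseudo_expectationD(2)[OF L(1)] poly_ring_var deg)
      finally show ?thesis .
    qed
    have xS: "x \<in> vec_space A" using L(2) A by (simp add: of_entries_in_vec_space)
    have entry: "Poly_Mapping.lookup x b = L (var b)" if "b \<in> A" for b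
      using that by (simp add: L(2) lookup_of_entries[OF A])
    have "g x = of_entries A (\<lambda>a. L (poly_hom \<sigma> (var a)))"
      using gS[OF xS] A
      by (intro vec_space_eqI[of _ A])
         (auto simp: of_entries_in_vec_space lookup_of_entries gx[OF xS] L\<sigma> L(2)[symmetric] entry
             mult.commute)
    moreover have "pseudo_expectation A ?I k (\<lambda>f. L (poly_hom \<sigma> f))"
      using L(1) \<sigma> ideal_vanishing_ideal \<sigma>I by (rule pseudo_expectation_compose)
    ultimately show ?thesis
      by (intro CollectI exI[of _ "\<lambda>f. L (poly_hom \<sigma> f)"]) auto
  qed
  \<comment> \<open>\<open>g\<close> is linear on the subspace only; \<open>G\<close> agrees with it there and is continuous everywhere\<close>
  define G where "G x = (\<Sum>b\<in>A. Poly_Mapping.lookup x b *\<^sub>R g (Poly_Mapping.single b 1))" for x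
  have "bounded_linear G"
    unfolding G_def by (intro bounded_linear_sum bounded_linear_scaleR_const bounded_linear_lookup)
  have Gg: "G x = g x" if "x \<in> vec_space A" for x
    using linear_automorphism_on_expansion[OF g(1) A that] by (simp add: G_def)
  have TS: "?T \<subseteq> vec_space A" using A by (auto simp: of_entries_in_vec_space)
  have "G ` closure ?T \<subseteq> closure ?T"
  proof (rule image_closure_subset)
    show "continuous_on (closure ?T) G" by (rule linear_continuous_on[OF \<open>bounded_linear G\<close>])
    show "G ` ?T \<subseteq> closure ?T"
      using gT Gg TS closure_subset by (smt (verit, best) image_subsetI subsetD)
  qed simp
  moreover have "closure ?T \<subseteq> vec_space A"
    by (rule closure_minimal[OF TS closed_vec_space])
  ultimately show ?thesis
    unfolding theta_body_eq_pseudo_expectation[OF ideal_vanishing_ideal k] using Gg by force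
qed

lemma theta_body_image_eq:
  assumes A: "finite A" and k: "k \<ge> 1"
    and V: "V \<subseteq> vec_space A" "\<And>v. v \<in> V \<Longrightarrow> (\<Sum>a\<in>A. (Poly_Mapping.lookup v a)\<^sup>2) = (c::real)"
    and g: "linear_automorphism_on (vec_space A) g" "g ` (convex hull V) = convex hull V"
  shows "g ` theta_body A (vanishing_ideal A V) k = theta_body A (vanishing_ideal A V) k"
proof
  let ?TH = "theta_body A (vanishing_ideal A V) k" and ?h = "inv_into (vec_space A) g"
  show "g ` ?TH \<subseteq> ?TH" by (rule theta_body_image_subset[OF assms])
  have bij: "bij_betw g (vec_space A) (vec_space A)"
    using g(1) by (simp add: linear_automorphism_on_def)
  have hull: "convex hull V \<subseteq> vec_space A" using convex_hull_subset_ball[OF V] by blast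
  have "?h ` g ` (convex hull V) = convex hull V"
    using bij hull by (simp add: bij_betw_def inv_into_image_cancel)
  then have "?h ` ?TH \<subseteq> ?TH"
    using g(2) by (intro theta_body_image_subset[OF A k V] linear_automorphism_on_inv_into g
        subspace_vec_space) auto
  moreover have "x = g (?h x)" if "x \<in> ?TH" for x
    using theta_body_subset[OF A ideal_vanishing_ideal k] that bij
    by (subst f_inv_into_f) (auto simp: bij_betw_def)
  ultimately show "?TH \<subseteq> g ` ?TH" by blast
qed

text \<open>
  The points of \<open>l\<^sub>1\<close> norm one are convex combinations of the signed coordinate vectors, with the
  absolute values of the entries as weights.
\<close>

lemma unit_sphere_subset_convex:
  assumes A: "finite A" and x: "x \<in> vec_space A" "norm x = 1" and C: "convex C"
    and unit: "\<And>a. a \<in> A \<Longrightarrow> Poly_Mapping.single a 1 \<in> C"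
        "\<And>a. a \<in> A \<Longrightarrow> - Poly_Mapping.single a (1::real) \<in> C"
  shows "x \<in> C"
proof -
  let ?e = "\<lambda>a. if Poly_Mapping.lookup x a < 0 then - Poly_Mapping.single a (1::real) else
      Poly_Mapping.single a 1"
  have "(\<Sum>a\<in>A. \<bar>Poly_Mapping.lookup x a\<bar> *\<^sub>R ?e a) \<in> C"
    using x(2) unit by (intro convex_sum[OF A C]) (auto simp: norm_vec_space[OF A x(1)])
  also have "(\<Sum>a\<in>A. \<bar>Poly_Mapping.lookup x a\<bar> *\<^sub>R ?e a)
    = (\<Sum>a\<in>A. Poly_Mapping.lookup x a *\<^sub>R Poly_Mapping.single a 1)"
    by (rule sum.cong) auto
  also have "\<dots> = x" using vec_space_expansion[OF A x(1)] by simp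
  finally show ?thesis .
qed

text \<open>
  The theta body contains the convex hull of \<open>V\<close>, hence all signed coordinate vectors and the
  whole \<open>l\<^sub>1\<close> ball. Symmetry comes from applying \<open>theta_body_image_subset\<close> to \<open>x \<mapsto> -x\<close>,
  boundedness from \<open>pseudo_expectation_bound\<close>.
\<close>

lemma theta_body_is_unit_ball:
  assumes A: "finite A" and ne: "A \<noteq> {}" and k: "k \<ge> 1"
    and V: "V \<subseteq> vec_space A" "\<And>v. v \<in> V \<Longrightarrow> (\<Sum>a\<in>A. (Poly_Mapping.lookup v a)\<^sup>2) = (c::real)"
    and neg: "\<And>v. v \<in> V \<Longrightarrow> - v \<in> V"
    and unit: "\<And>a. a \<in> A \<Longrightarrow> Poly_Mapping.single a 1 \<in> convex hull V"
  shows "\<exists>N. norm_on (vec_space A) N \<and>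
    theta_body A (vanishing_ideal A V) k = {x \<in> vec_space A. N x \<le> 1}"
proof -
  let ?I = "vanishing_ideal A V"
  define TH where "TH = theta_body A ?I k"
  define T where "T = {of_entries A (\<lambda>a. L (var a)) | L. pseudo_expectation A ?I k L}"
  have TH: "TH = closure T"
    unfolding TH_def T_def by (rule theta_body_eq_pseudo_expectation[OF ideal_vanishing_ideal k])
  have THS: "TH \<subseteq> vec_space A"
    unfolding TH_def by (rule theta_body_subset[OF A ideal_vanishing_ideal k])
  have "convex T"
  proof (rule convexI)
    fix x y and u v :: real assume "x \<in> T" "y \<in> T" and uv: "0 \<le> u" "0 \<le> v" "u + v = 1"
    then obtain L M where LM: "pseudo_expectation A ?I k L" "x = of_entries A (\<lambda>a. L (var a))"
      "pseudo_expectation A ?I k M" "y = of_entries A (\<lambda>a. M (var a))" by (auto simp: T_def)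
    have "u *\<^sub>R x + v *\<^sub>R y = of_entries A (\<lambda>a. u * L (var a) + v * M (var a))"
      unfolding LM by (rule poly_mapping_eqI) (simp add: lookup_add lookup_of_entries[OF A])
    then show "u *\<^sub>R x + v *\<^sub>R y \<in> T"
      unfolding T_def using pseudo_expectation_convex[OF LM(1,3) uv]
      by (intro CollectI exI[of _ "\<lambda>f. u * L f + v * M f"]) auto
  qed
  then have convex: "convex TH" unfolding TH by (rule convex_closure)
  have "V \<subseteq> T"
  proof
    fix x assume x: "x \<in> V"
    have "pseudo_expectation A ?I k (poly_hom (Poly_Mapping.lookup x))"
      using x by (intro pseudo_expectation_eval) (simp add: vanishing_ideal_def)
    moreover have "x = of_entries A (\<lambda>a. poly_hom (Poly_Mapping.lookup x) (var a))"
      using x V(1) by (simp add: of_entries_lookup[OF A] subset_iff)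
    ultimately show "x \<in> T" unfolding T_def by blast
  qed
  then have hull: "convex hull V \<subseteq> TH"
    using closure_subset[of T] convex unfolding TH by (intro hull_minimal) auto
  have uminus_aut: "linear_automorphism_on (vec_space A) (uminus :: ('a \<Rightarrow>\<^sub>0 real) \<Rightarrow> _)"
    unfolding linear_automorphism_on_def
    by (auto intro!: bij_betw_byWitness[of _ uminus] subspace_neg subspace_vec_space)
  have "uminus ` V = V"
    using neg by (auto simp: image_iff) (metis minus_minus)
  then have "uminus ` (convex hull V) = convex hull V"
    by (simp add: convex_hull_linear_image[OF linear_uminus])
  then have TH_neg: "- x \<in> TH" if "x \<in> TH" for x
    using theta_body_image_subset[OF A k V uminus_aut] that by (auto simp: TH_def)
  have sphere: "(\<Sum>b\<in>A. var b ^ 2) - const c \<in> ?I"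
    using V(2) by (auto simp: vanishing_ideal_def poly_hom_simps intro!: poly_ring_closed)
  have bound: "norm x \<le> real (card A) * ((1 + c) / 2)" if "x \<in> TH" for x
  proof -
    have "T \<subseteq> cball 0 (real (card A) * ((1 + c) / 2))"
    proof
      fix x assume "x \<in> T"
      then obtain L where L: "pseudo_expectation A ?I k L" "x = of_entries A (\<lambda>a. L (var a))"
        by (auto simp: T_def)
      have "norm x = (\<Sum>a\<in>A. \<bar>Poly_Mapping.lookup x a\<bar>)"
        by (rule norm_vec_space[OF A]) (simp add: L(2) of_entries_in_vec_space A)
      also have "\<dots> \<le> (\<Sum>a\<in>A. (1 + c) / 2)"
        using pseudo_expectation_bound[OF L(1) k A _ sphere]
        by (intro sum_mono) (simp add: L(2) lookup_of_entries[OF A])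
      finally show "x \<in> cball 0 (real (card A) * ((1 + c) / 2))" by simp
    qed
    then have "TH \<subseteq> cball 0 (real (card A) * ((1 + c) / 2))"
      unfolding TH by (rule closure_minimal) simp
    then show ?thesis using that by auto
  qed
  have ball1: "x \<in> TH" if "x \<in> vec_space A" "norm x = 1" for x
  proof (rule unit_sphere_subset_convex[OF A that convex])
    show e: "Poly_Mapping.single a 1 \<in> TH" if "a \<in> A" for a using unit[OF that] hull
        by (rule rev_subsetD)
    show "- Poly_Mapping.single a (1::real) \<in> TH" if "a \<in> A" for a using e[OF that] by (rule TH_neg)
  qed
  obtain a where a: "a \<in> A" using ne by blast
    have zero: "0 \<in> TH"
    proof -
      have e: "Poly_Mapping.single a 1 \<in> TH" using unit[OF a] hull by blast
      have "(1/2) *\<^sub>R Poly_Mapping.single a (1::real) + (1/2) *\<^sub>R - Poly_Mapping.single a 1 \<in> TH"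
        by (rule convexD[OF convex e TH_neg[OF e]]) auto
      then show ?thesis by simp
    qed
    have ball: "x \<in> TH" if x: "x \<in> vec_space A" "norm x \<le> 1" for x
    proof (cases "x = 0")
      case False
      have "(1 / norm x) *\<^sub>R x \<in> TH"
        using x False by (intro ball1) (auto intro: subspace_scale subspace_vec_space)
      then have "(1 - norm x) *\<^sub>R 0 + norm x *\<^sub>R (1 / norm x) *\<^sub>R x \<in> TH"
        using x by (intro convexD_alt[OF convex zero]) auto
      then show ?thesis using False by simp
    qed (simp add: zero)
    show ?thesis
      unfolding TH_def[symmetric]
      by (rule norm_on_of_unit_ball[OF subspace_vec_space THS _ convex TH_neg _ ball bound, of 1])
         (auto simp: TH)
qed

section \<open>Rank-one tensors\<close>

lemma index_setD:
  "a \<in> index_set n \<Longrightarrow> length a = length n"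
  "\<lbrakk>a \<in> index_set n; i < length n\<rbrakk> \<Longrightarrow> a ! i \<in> {1..n ! i}"
  by (auto simp: index_set_def)

lemma index_set_Nil: "index_set [] = {[]}"
  by (auto simp: index_set_def)

lemma index_set_Cons: "index_set (m # n) = (\<lambda>(j, a). j # a) ` ({1..m} \<times> index_set n)"
proof (intro equalityI subsetI)
  fix a assume a: "a \<in> index_set (m # n)"
  then obtain j b where ab: "a = j # b" by (cases a) (auto simp: index_set_def)
  have "j \<in> {1..m}" using index_setD(2)[OF a, of 0] ab by simp
  moreover have "b \<in> index_set n"
    using index_setD(1)[OF a] index_setD(2)[OF a, of "Suc _"] ab by (auto simp: index_set_def)
  ultimately show "a \<in> (\<lambda>(j, a). j # a) ` ({1..m} \<times> index_set n)" using ab by auto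
qed (auto simp: index_set_def nth_Cons split: nat.splits)

lemma finite_index_set: "finite (index_set n)"
  by (induction n) (auto simp: index_set_Nil index_set_Cons)

text \<open>
  The source of the multiplicativity of norms of rank-one tensors.
\<close>

lemma sum_index_set_prod:
  fixes f :: "nat \<Rightarrow> nat \<Rightarrow> 'r::comm_semiring_1"
  shows "(\<Sum>a\<in>index_set n. \<Prod>i<length n. f i (a ! i)) = (\<Prod>i<length n. \<Sum>j=1..n ! i. f i j)"
proof (induction n arbitrary: f)
  case (Cons m n)
  have "(\<Sum>a\<in>index_set (m # n). \<Prod>i<length (m # n). f i (a ! i)) =
      (\<Sum>(j, a)\<in>{1..m} \<times> index_set n. f 0 j * (\<Prod>i<length n. f (Suc i) (a ! i)))"
    unfolding index_set_Cons
    by (subst sum.reindex) (auto simp: inj_on_def prod.lessThan_Suc_shift case_prod_unfold simp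
        del: prod.lessThan_Suc)
  also have "\<dots> = (\<Sum>j=1..m. f 0 j) * (\<Sum>a\<in>index_set n. \<Prod>i<length n. f (Suc i) (a ! i))"
    by (simp add: sum_product sum.cartesian_product)
  also have "(\<Sum>a\<in>index_set n. \<Prod>i<length n. f (Suc i) (a ! i)) =
      (\<Prod>i<length n. \<Sum>j=1..n ! i. f (Suc i) j)"
    by (rule Cons.IH)
  also have "(\<Sum>j=1..m. f 0 j) * (\<Prod>i<length n. \<Sum>j=1..n ! i. f (Suc i) j)
      = (\<Prod>i<length (m # n). \<Sum>j=1..(m # n) ! i. f i j)"
    by (simp add: prod.lessThan_Suc_shift del: prod.lessThan_Suc)
  finally show ?case .
qed (simp add: index_set_Nil)

lemma index_set_update: "\<lbrakk>a \<in> index_set n; j \<in> {1..n ! i}\<rbrakk> \<Longrightarrow> a[i := j] \<in> index_set n"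
  by (cases "i < length a") (auto simp: index_set_def nth_list_update list_update_beyond)

lemma index_meet_join_nth:
  assumes "a \<in> index_set n" "b \<in> index_set n" "i < length n"
  shows "index_meet a b ! i = min (a ! i) (b ! i)" "index_join a b ! i = max (a ! i) (b ! i)"
  using assms by (simp_all add: index_meet_def index_join_def index_setD(1))

lemma index_meet_join_closed:
  assumes "a \<in> index_set n" "b \<in> index_set n"
  shows "index_meet a b \<in> index_set n" "index_join a b \<in> index_set n"
  using assms
  by (auto simp: index_set_def
      index_meet_join_nth[OF assms, simplified index_set_def, simplified] index_meet_def
      index_join_def min_def max_def)

lemma lookup_outer_product:
  "Poly_Mapping.lookup (outer_product n v) a =
      (if a \<in> index_set n then \<Prod>i<length n. v i (a ! i) else 0)"
  by (simp add: outer_product_def lookup_of_entries finite_index_set)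

lemma outer_product_in_vec_space: "outer_product n v \<in> vec_space (index_set n)"
  by (simp add: outer_product_def of_entries_in_vec_space finite_index_set)

lemma outer_product_square_sum:
  "(\<Sum>a\<in>index_set n. (Poly_Mapping.lookup (outer_product n v) a)\<^sup>2) =
      (\<Prod>i<length n. \<Sum>j=1..n ! i. (v i j)\<^sup>2)"
  using sum_index_set_prod[where n = n and f = "\<lambda>i j. (v i j)\<^sup>2"]
  by (simp add: lookup_outer_product prod_power_distrib)

lemma outer_product_norm:
  "norm (outer_product n v) = (\<Prod>i<length n. \<Sum>j=1..n ! i. \<bar>v i j\<bar>)"
  using sum_index_set_prod[where n = n and f = "\<lambda>i j. \<bar>v i j\<bar>"]
  by (simp add: norm_vec_space[OF finite_index_set outer_product_in_vec_space]
      lookup_outer_product abs_prod)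

text \<open>
  A sign is absorbed by a single factor, so there has to be at least one factor.
\<close>

lemma uminus_outer_product:
  assumes "n \<noteq> []"
  shows "- outer_product n v = outer_product n (v(0 := (\<lambda>j. - v 0 j)))"
proof (rule poly_mapping_eqI)
  fix a
  obtain l where l: "length n = Suc l" using assms by (cases n) auto
  show "Poly_Mapping.lookup (- outer_product n v) a =
      Poly_Mapping.lookup (outer_product n (v(0 := (\<lambda>j. - v 0 j)))) a"
    by (simp add: lookup_outer_product l prod.lessThan_Suc_shift del: prod.lessThan_Suc)
qed

text \<open>
  In each position the pair of the minimum and the maximum is a rearrangement of the pair of
  indices, so both products consist of the same factors.
\<close>

lemma outer_product_meet_join:
  assumes "a \<in> index_set n" "b \<in> index_set n"
  shows "Poly_Mapping.lookup (outer_product n v) a * Poly_Mapping.lookup (outer_product n v) b =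
    Poly_Mapping.lookup (outer_product n v) (index_meet a b) * Poly_Mapping.lookup
        (outer_product n v) (index_join a b)"
  using assms
  by (auto simp: lookup_outer_product index_meet_join_closed index_meet_join_nth min_def max_def
      prod.distrib[symmetric] intro!: prod.cong)

lemma single_eq_outer_product:
  assumes a: "a \<in> index_set n"
  shows "Poly_Mapping.single a 1 = outer_product n (\<lambda>i j. if j = a ! i then 1 else 0)"
proof (rule poly_mapping_eqI)
  fix b
  show "Poly_Mapping.lookup (Poly_Mapping.single a 1) b =
      Poly_Mapping.lookup (outer_product n (\<lambda>i j. if j = a ! i then 1 else 0 :: real)) b"
  proof (cases "b \<in> index_set n \<and> b \<noteq> a")
    case True
    then obtain i where "i < length n" "b ! i \<noteq> a ! i"
      using a index_setD(1) by (metis nth_equalityI)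
    then have prod0: "(\<Prod>i<length n. if b ! i = a ! i then 1 else 0 :: real) = 0"
      by (intro prod_zero) auto
    show ?thesis using True by (auto simp: lookup_outer_product lookup_single prod0 when_def)
  qed (use a in \<open>auto simp: lookup_outer_product lookup_single when_def\<close>)
qed

section \<open>Vectors of norm one\<close>

lemma p_norm_1: "p_norm 1 m v = (\<Sum>j=1..m. \<bar>v j\<bar>)"
  by (simp add: p_norm_def one_enat_def)

lemma p_norm_2_eq_1_iff: "p_norm 2 m v = 1 \<longleftrightarrow> (\<Sum>j=1..m. (v j)\<^sup>2) = 1"
  by (simp add: p_norm_def numeral_eq_enat)

lemma p_norm_inf_eq_1_iff:
  "p_norm \<infinity> m v = 1 \<longleftrightarrow> (\<forall>j\<in>{1..m}. \<bar>v j\<bar> \<le> 1) \<and> (\<exists>j\<in>{1..m}. \<bar>v j\<bar> = 1)" if "m \<ge> 1"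
  using that by (auto simp: p_norm_def Max_eq_iff image_iff) 

text \<open>
  Coordinate tensors are outer products of coordinate vectors, which have \<open>p\<close>-norm one for every
  \<open>p\<close>.
\<close>

lemma single_in_nuclear_ball:
  assumes p: "p \<in> {1, 2, \<infinity>}" and a: "a \<in> index_set n"
  shows "Poly_Mapping.single a 1 \<in> nuclear_ball p n"
proof -
  have "p_norm p (n ! i) (\<lambda>j. if j = a ! i then 1 else 0) = 1" if "i < length n" for i
  proof -
    have ai: "a ! i \<in> {1..n ! i}" using index_setD(2)[OF a that] .
    then have "n ! i \<ge> 1" by auto
    then show ?thesis
      using p ai by (auto simp: p_norm_1 p_norm_2_eq_1_iff p_norm_inf_eq_1_iff
          if_distrib[of abs] if_distrib[of "\<lambda>x. x\<^sup>2"] sum.delta cong: if_cong)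
  qed
  then show ?thesis
    unfolding nuclear_ball_def single_eq_outer_product[OF a] by (intro hull_inc) blast
qed

section \<open>Vanishing ideals of finite sets of points\<close>

lemma ideal_genideal_poly_ring:
  assumes "G \<subseteq> carrier (poly_ring A)"
  shows "ideal (Idl\<^bsub>poly_ring A\<^esub> G) (poly_ring A)" "G \<subseteq> Idl\<^bsub>poly_ring A\<^esub> G"
  using ring.genideal_ideal[OF _ assms] ring.genideal_self[OF _ assms]
      cring_poly_ring[THEN cring.axioms(1)] by auto

lemma genideal_eq_vanishing_ideal:
  assumes G: "G \<subseteq> vanishing_ideal A V"
    and sub: "\<And>f. f \<in> vanishing_ideal A V \<Longrightarrow> f \<in> Idl\<^bsub>poly_ring A\<^esub> G"
  shows "Idl\<^bsub>poly_ring A\<^esub> G = vanishing_ideal A V"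
  using ring.genideal_minimal[OF cring_poly_ring[THEN cring.axioms(1)] ideal_vanishing_ideal G]
      sub by blast

text \<open>
  The polynomials \<open>L s a\<close> play the role of Lagrange basis polynomials in the variable \<open>a\<close> with
  nodes \<open>S\<close>. The product \<open>e\<close> of those belonging to a grid point \<open>x\<close> is an idempotent modulo \<open>I\<close>
  that turns every polynomial into its value at \<open>x\<close>. If \<open>x\<close> is not a zero of \<open>I\<close>, some member of
  \<open>I\<close> has a nonzero value there, which puts \<open>e\<close> itself into \<open>I\<close>; if it is a zero, \<open>f\<close> is zero at
  \<open>x\<close>. In both cases \<open>f * e\<close> lies in \<open>I\<close>, and \<open>f\<close> is the sum of these products over all grid
  points.
\<close>

lemma grid_ideal_membership:
  fixes L :: "real \<Rightarrow> 'a \<Rightarrow> 'a mpoly"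
  assumes I: "ideal I (poly_ring A)" and A: "finite A"
    and L: "\<And>s a. a \<in> A \<Longrightarrow> L s a \<in> carrier (poly_ring A)"
    and L_sum: "\<And>a. a \<in> A \<Longrightarrow> (\<Sum>s\<in>S. L s a) = 1"
    and L_I: "\<And>s a. \<lbrakk>s \<in> S; a \<in> A\<rbrakk> \<Longrightarrow> (var a - const s) * L s a \<in> I"
    and f: "f \<in> carrier (poly_ring A)"
    and vanish: "\<And>x. \<lbrakk>\<And>a. a \<in> A \<Longrightarrow> x a \<in> S; \<And>h. h \<in> I \<Longrightarrow> poly_hom x h = 0\<rbrakk> \<Longrightarrow> poly_hom x f = 0"
  shows "f \<in> I"
proof -
  note cl = ideal_poly_ring_closed[OF I]
  define e where "e x B = (\<Prod>a\<in>B. L (x a) a)" for x B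
  have e_closed: "e x B \<in> carrier (poly_ring A)" if "B \<subseteq> A" for x B
    unfolding e_def using that by (auto intro!: poly_ring_prod L)
  have at_point: "(h - const (poly_hom x h)) * e x A \<in> I"
    if x: "\<And>a. a \<in> A \<Longrightarrow> x a \<in> S" and h: "h \<in> carrier (poly_ring A)" for x :: "'a \<Rightarrow> real" and h
    using h
  proof (induction rule: poly_ring_induct)
    case (const c)
    then show ?case using cl(2) by simp
  next
    case (var a)
    have "(var a - const (x a)) * e x A = e x (A - {a}) * ((var a - const (x a)) * L (x a) a)"
      using A var by (simp add: e_def prod.remove[of A a] mult_ac)
    also have "\<dots> \<in> I" using var x by (intro cl(4) e_closed L_I) auto
    finally show ?case by simp
  next
    case (add f g)
    have "const (poly_hom x f + poly_hom x g) =
        const (poly_hom x f) + (const (poly_hom x g) :: 'a mpoly)"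
      by (simp add: const_def single_add)
    then show ?case
      using cl(3)[OF add(3,4)] by (simp add: poly_hom_add algebra_simps)
  next
    case (mult f g)
    have "const (poly_hom x f * poly_hom x g) =
        const (poly_hom x f) * (const (poly_hom x g) :: 'a mpoly)"
      by (simp add: const_def mult_single)
    then have "(f * g - const (poly_hom x (f * g))) * e x A =
        g * ((f - const (poly_hom x f)) * e x A) + const (poly_hom x f) *
            ((g - const (poly_hom x g)) * e x A)"
      by (simp add: poly_hom_mult algebra_simps)
    also have "\<dots> \<in> I"
      by (intro cl(3) cl(4) mult poly_ring_const)
    finally show ?case .
  qed
  have point: "f * e x A \<in> I" if x: "\<And>a. a \<in> A \<Longrightarrow> x a \<in> S" for x
  proof (cases "\<forall>h\<in>I. poly_hom x h = 0")
    case True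
    then have 0: "poly_hom x f = 0" using vanish x by blast
    have "(f - const (poly_hom x f)) * e x A \<in> I" using x f by (rule at_point)
    then show ?thesis by (simp add: 0)
  next
    case False
    then obtain h where h: "h \<in> I" "poly_hom x h \<noteq> 0" by blast
    have "poly_hom x h *\<^sub>R e x A = e x A * h - (h - const (poly_hom x h)) * e x A"
      by (simp add: algebra_simps const_mult[symmetric])
    also have "\<dots> \<in> I"
      using h by (intro cl(7) cl(4) e_closed at_point x cl(1)) auto
    finally have "(1 / poly_hom x h) *\<^sub>R poly_hom x h *\<^sub>R e x A \<in> I" by (rule cl(5))
    then have "e x A \<in> I" using h(2) by simp
    then show ?thesis by (intro cl(4) f)
  qed
  have "f \<in> I" if "finite B" "B \<subseteq> A" "\<And>x. (\<And>a. a \<in> B \<Longrightarrow> x a \<in> S) \<Longrightarrow> f * e x B \<in> I" for B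
    using that
  proof (induction B rule: finite_induct)
    case empty
    then show ?case by (simp add: e_def)
  next
    case (insert b B)
    have "f * e x B \<in> I" if x: "\<And>a. a \<in> B \<Longrightarrow> x a \<in> S" for x
    proof -
      have "f * e x B = (\<Sum>s\<in>S. f * e (x(b := s)) (insert b B))"
      proof -
        have "e (x(b := s)) (insert b B) = L s b * e x B" for s
        proof -
          have "(\<Prod>a\<in>B. L ((x(b := s)) a) a) = (\<Prod>a\<in>B. L (x a) a)"
            using insert.hyps by (intro prod.cong) auto
          then show ?thesis using insert.hyps by (simp add: e_def)
        qed
        then have "(\<Sum>s\<in>S. f * e (x(b := s)) (insert b B)) = f * e x B * (\<Sum>s\<in>S. L s b)"
          by (simp add: sum_distrib_left mult_ac)
        then show ?thesis using L_sum insert.prems by simp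
      qed
      also have "\<dots> \<in> I"
        using x by (intro ideal_poly_ring_sum[OF I] insert.prems(2)) auto
      finally show ?thesis .
    qed
    then show ?case using insert by blast
  qed
  then show ?thesis using A point by blast
qed

section \<open>The case p = 1\<close>

definition signed_units :: "'a set \<Rightarrow> ('a \<Rightarrow>\<^sub>0 real) set" where
  "signed_units A = {Poly_Mapping.single a s | a s. a \<in> A \<and> s \<in> {1, -1}}"

lemma signed_units_subset: "signed_units A \<subseteq> vec_space A"
  by (auto simp: signed_units_def single_in_vec_space)

lemma uminus_signed_units:
  assumes "v \<in> signed_units A"
  shows "- v \<in> signed_units A"
proof -
  obtain a s where "v = Poly_Mapping.single a s" "a \<in> A" "s \<in> {1, -1}"
    using assms by (auto simp: signed_units_def)
  then have "- v = Poly_Mapping.single a (- s)" "a \<in> A" "- s \<in> {1, -1}"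
    by (auto simp: single_uminus)
  then show ?thesis unfolding signed_units_def by blast
qed

text \<open>
  The \<open>l\<^sub>1\<close> norm is multiplicative on outer products, so the generators of the ball lie on the
  unit sphere of the \<open>l\<^sub>1\<close> norm on tensors, whose points are combinations of signed coordinate
  tensors.
\<close>

lemma nuclear_ball_1:
  assumes "n \<noteq> []"
  shows "nuclear_ball 1 n = convex hull (signed_units (index_set n))"
proof
  have unit: "Poly_Mapping.single a 1 \<in> convex hull (signed_units (index_set n))"
    "- Poly_Mapping.single a 1 \<in> convex hull (signed_units (index_set n))" if "a \<in> index_set n"
        for a
    using that unfolding single_uminus[symmetric] by (auto intro!: hull_inc simp: signed_units_def)
  show "nuclear_ball 1 n \<subseteq> convex hull (signed_units (index_set n))"
    unfolding nuclear_ball_def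
  proof (rule hull_minimal, rule subsetI)
    fix x assume "x \<in> {outer_product n v | v. \<forall>i<length n. p_norm 1 (n ! i) (v i) = 1}"
    then obtain v where v: "x = outer_product n v" "\<forall>i<length n. (\<Sum>j=1..n ! i. \<bar>v i j\<bar>) = 1"
      by (auto simp: p_norm_1)
    then have n: "norm x = 1" by (simp add: outer_product_norm)
    have m: "x \<in> vec_space (index_set n)"
      by (simp add: v(1) outer_product_in_vec_space)
    show "x \<in> convex hull (signed_units (index_set n))"
      by (rule unit_sphere_subset_convex[OF finite_index_set m n convex_convex_hull])
          (simp_all add: unit)
  qed simp
  show "convex hull (signed_units (index_set n)) \<subseteq> nuclear_ball 1 n"
  proof (rule hull_minimal, rule subsetI)
    fix x assume "x \<in> signed_units (index_set n)"
    then obtain a where a: "a \<in> index_set n"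
        "x = Poly_Mapping.single a 1 \<or> x = - Poly_Mapping.single a 1"
      by (auto simp: signed_units_def single_uminus)
    have "x \<in> nuclear_ball 1 n" if "x = - Poly_Mapping.single a 1"
    proof -
      let ?v = "\<lambda>i j. if j = a ! i then 1 else 0 :: real"
      have "p_norm 1 (n ! i) (?v i) = 1" if "i < length n" for i
        using index_setD(2)[OF a(1) that]
            by (auto simp: p_norm_1 if_distrib sum.delta cong: if_cong)
      then have "\<forall>i<length n. p_norm 1 (n ! i) ((?v(0 := (\<lambda>j. - ?v 0 j))) i) = 1"
        using assms by (auto simp: p_norm_1)
      then show ?thesis
        unfolding nuclear_ball_def that single_eq_outer_product[OF a(1)]
            uminus_outer_product[OF assms]
        by (intro hull_inc) blast
    qed
    then show "x \<in> nuclear_ball 1 n" using a single_in_nuclear_ball[of 1] by auto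
  qed (simp add: nuclear_ball_def)
qed

lemma signed_units_square_sum:
  assumes "finite A" "v \<in> signed_units A"
  shows "(\<Sum>a\<in>A. (Poly_Mapping.lookup v a)\<^sup>2) = 1"
  using assms by (auto simp: signed_units_def lookup_single when_def if_distrib[of "\<lambda>x. x\<^sup>2"]
      sum.delta' cong: if_cong)

text \<open>
  On the grid \<open>{-1, 0, 1}\<close> the products of distinct variables leave at most one nonzero entry and
  the sum of squares leaves at least one; these are the signed coordinate tensors.
\<close>

lemma ideal_1_eq_vanishing_ideal:
    "ideal_1 n = vanishing_ideal (index_set n) (signed_units (index_set n))"
  unfolding ideal_1_def
proof (rule genideal_eq_vanishing_ideal)
  let ?A = "index_set n"
  let ?G = "{var a ^ 3 - var a | a. a \<in> ?A} \<union> {var a * var b | a b. a \<in> ?A \<and> b \<in> ?A \<and> a \<noteq> b} \<union>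
       {(\<Sum>a\<in>?A. var a ^ 2) - 1}"
  show G: "?G \<subseteq> vanishing_ideal ?A (signed_units ?A)"
  proof -
    have "var a ^ 3 - var a \<in> vanishing_ideal ?A (signed_units ?A)" if "a \<in> ?A" for a
      using that by (auto simp: vanishing_ideal_def poly_hom_simps signed_units_def lookup_single
          when_def
          poly_ring_diff poly_ring_power poly_ring_var)
    moreover have "var a * var b \<in> vanishing_ideal ?A (signed_units ?A)"
        if "a \<in> ?A" "b \<in> ?A" "a \<noteq> b" for a b
      using that by (auto simp: vanishing_ideal_def poly_hom_simps signed_units_def lookup_single
          when_def
          poly_ring_mult poly_ring_var)
    moreover have "(\<Sum>a\<in>?A. var a ^ 2) - 1 \<in> vanishing_ideal ?A (signed_units ?A)"
      using signed_units_square_sum[OF finite_index_set]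
      by (auto simp: vanishing_ideal_def poly_hom_simps intro!: poly_ring_closed)
    ultimately show ?thesis by blast
  qed
  then have "?G \<subseteq> carrier (poly_ring ?A)"
    by (rule order_trans) (auto simp: vanishing_ideal_def)
  note I = ideal_genideal_poly_ring[OF this]
  fix f assume f: "f \<in> vanishing_ideal ?A (signed_units ?A)"
  define L :: "real \<Rightarrow> nat list \<Rightarrow> nat list mpoly" where
    \<comment> \<open>Lagrange basis polynomials for the nodes \<open>-1, 0, 1\<close>\<close>
    "L s a = (if s = 0 then 1 - var a ^ 2 else (1 / 2) *\<^sub>R (var a ^ 2 + s *\<^sub>R var a))" for s a
  show "f \<in> Idl\<^bsub>poly_ring ?A\<^esub> ?G"
  proof (rule grid_ideal_membership[OF I(1) finite_index_set, where S = "{-1, 0, 1}" and L = L])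
    show "L s a \<in> carrier (poly_ring ?A)" if "a \<in> ?A" for s a
      using that by (auto simp: L_def intro!: poly_ring_closed)
    show "(\<Sum>s\<in>{-1, 0, 1}. L s a) = 1" for a
    proof -
      have L1: "L (-1) a = (1 / 2) *\<^sub>R (var a ^ 2 - var a)"
          "L 1 a = (1 / 2) *\<^sub>R (var a ^ 2 + var a)"
        by (simp_all add: L_def)
      have "L (-1) a + L 1 a = (1 / 2) *\<^sub>R ((var a ^ 2 - var a) + (var a ^ 2 + var a))"
        unfolding L1 by (simp only: scaleR_add_right)
      also have "(var a ^ 2 - var a) + (var a ^ 2 + var a) = 2 *\<^sub>R var a ^ 2"
        by (simp add: scaleR_2)
      finally have "L (-1) a + L 1 a = var a ^ 2" by simp
      moreover have "(\<Sum>s\<in>{-1, 0, 1}. L s a) = L 0 a + (L (-1) a + L 1 a)" by simp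
      ultimately show ?thesis by (simp add: L_def)
    qed
    show "(var a - const s) * L s a \<in> Idl\<^bsub>poly_ring ?A\<^esub> ?G" if "s \<in> {-1, 0, 1}" "a \<in> ?A" for s a
    proof -
      have *: "var a ^ 3 - var a \<in> Idl\<^bsub>poly_ring ?A\<^esub> ?G" using I(2) that(2) by blast
      have "(var a - const s) * L s a = (if s = 0 then -1 else 1 / 2) *\<^sub>R (var a ^ 3 - var a)"
      proof (cases "s = 0")
        case False
        then have s: "s * s = 1" using that(1) by auto
        have "(var a - const s) * (var a ^ 2 + s *\<^sub>R var a) = var a ^ 3 - (s * s) *\<^sub>R var a"
          by (simp add: algebra_simps const_mult power2_eq_square power3_eq_cube)
        then show ?thesis using False s by (simp add: L_def)
      qed (simp add: L_def algebra_simps power2_eq_square power3_eq_cube)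
      then show ?thesis using ideal_poly_ring_scaleR[OF I(1) *] by simp
    qed
    show "f \<in> carrier (poly_ring ?A)" using f by (simp add: vanishing_ideal_def)
  next
    fix x :: "nat list \<Rightarrow> real"
    assume x: "\<And>a. a \<in> ?A \<Longrightarrow> x a \<in> {-1, 0, 1}"
        and h: "\<And>h. h \<in> Idl\<^bsub>poly_ring ?A\<^esub> ?G \<Longrightarrow> poly_hom x h = 0"
    have orth: "x a * x b = 0" if "a \<in> ?A" "b \<in> ?A" "a \<noteq> b" for a b
      using h[of "var a * var b"] I(2) that by (auto simp: poly_hom_simps)
    have "poly_hom x ((\<Sum>a\<in>?A. var a ^ 2) - 1) = 0" using I(2) by (intro h) blast
    then have "(\<Sum>a\<in>?A. (x a)\<^sup>2) = 1" by (simp add: poly_hom_simps)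
    then obtain a where a: "a \<in> ?A" "x a \<noteq> 0"
      by (metis (no_types, lifting) sum.neutral zero_neq_one power_zero_numeral)
    have "Poly_Mapping.single a (x a) \<in> signed_units ?A"
      using a x[of a] by (auto simp: signed_units_def)
    then have "poly_hom (Poly_Mapping.lookup (Poly_Mapping.single a (x a))) f = 0"
      using f by (auto simp: vanishing_ideal_def)
    moreover have "x b = Poly_Mapping.lookup (Poly_Mapping.single a (x a)) b" if "b \<in> ?A" for b
      using orth[OF a(1) that] a by (auto simp: lookup_single when_def)
    ultimately show "poly_hom x f = 0"
      using poly_hom_cong[of f ?A x] f by (auto simp: vanishing_ideal_def)
  qed
qed

section \<open>The case p = infinity\<close>

definition sign_tensors :: "nat list \<Rightarrow> (nat list \<Rightarrow>\<^sub>0 real) set" where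
  "sign_tensors n = {outer_product n v | v. \<forall>i<length n. \<forall>j\<in>{1..n ! i}. \<bar>v i j\<bar> = 1}"

lemma sign_tensors_subset: "sign_tensors n \<subseteq> vec_space (index_set n)"
  by (auto simp: sign_tensors_def outer_product_in_vec_space)

lemma uminus_sign_tensors:
  assumes "n \<noteq> []" "v \<in> sign_tensors n"
  shows "- v \<in> sign_tensors n"
proof -
  obtain w where w: "v = outer_product n w" "\<forall>i<length n. \<forall>j\<in>{1..n ! i}. \<bar>w i j\<bar> = 1"
    using assms(2) unfolding sign_tensors_def by blast
  have "\<forall>i<length n. \<forall>j\<in>{1..n ! i}. \<bar>(w(0 := (\<lambda>j. - w 0 j))) i j\<bar> = 1" using w(2) by auto
  then show ?thesis
    unfolding sign_tensors_def w(1) uminus_outer_product[OF assms(1)] by blast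
qed

text \<open>
  The outer product is affine in each single entry of each factor. An entry in \<open>[-1, 1]\<close> is a
  convex combination of \<open>1\<close> and \<open>-1\<close>, so the entries can be replaced by signs one after the other;
  \<open>F\<close> is the set of positions that are still to be replaced.
\<close>

lemma outer_product_in_hull_sign_tensors:
  assumes "finite F" "F \<subseteq> {(i, j). i < length n \<and> j \<in> {1..n ! i}}"
    and "\<And>i j. \<lbrakk>i < length n; j \<in> {1..n ! i}\<rbrakk> \<Longrightarrow> \<bar>v i j\<bar> \<le> 1"
    and "\<And>i j. \<lbrakk>i < length n; j \<in> {1..n ! i}; (i, j) \<notin> F\<rbrakk> \<Longrightarrow> \<bar>v i j\<bar> = 1"
  shows "outer_product n v \<in> convex hull (sign_tensors n)"
  using assms
proof (induction F arbitrary: v rule: finite_induct)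
  case empty
  then have "outer_product n v \<in> sign_tensors n" unfolding sign_tensors_def by blast
  then show ?case by (rule hull_inc)
next
  case (insert q F)
  obtain i j where q: "q = (i, j)" by (cases q)
  then have ij: "i < length n" "j \<in> {1..n ! i}" using insert.prems(1) by auto
  define w where "w s = v(i := (v i)(j := s))" for s :: real
  have w: "outer_product n (w s) \<in> convex hull (sign_tensors n)" if s: "\<bar>s\<bar> = 1" for s
  proof (rule insert.IH)
    show "F \<subseteq> {(i, j). i < length n \<and> j \<in> {1..n ! i}}" using insert.prems(1) by simp
    show "\<bar>w s i' j'\<bar> \<le> 1" if "i' < length n" "j' \<in> {1..n ! i'}" for i' j'
      using insert.prems(2)[OF that] s by (auto simp: w_def)
    show "\<bar>w s i' j'\<bar> = 1" if "i' < length n" "j' \<in> {1..n ! i'}" "(i', j') \<notin> F" for i' j'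
      using insert.prems(3)[OF that(1,2)] that(3) s by (auto simp: w_def q)
  qed
  \<comment> \<open>the weight with \<open>v i j = (1 - u) * (-1) + u * 1\<close>\<close>
  define u where "u = (1 + v i j) / 2"
  have u: "0 \<le> u" "u \<le> 1" using insert.prems(2)[OF ij] by (auto simp: u_def abs_le_iff)
  have "outer_product n v = (1 - u) *\<^sub>R outer_product n (w (-1)) + u *\<^sub>R outer_product n (w 1)"
  proof (rule poly_mapping_eqI)
    fix a
    define R where "R = (\<Prod>k\<in>{..<length n} - {i}. v k (a ! k))"
    have split: "(\<Prod>k<length n. f k) = f i * (\<Prod>k\<in>{..<length n} - {i}. f k)" for f :: "nat \<Rightarrow> real"
      using ij(1) by (intro prod.remove) auto
    have wR: "(\<Prod>k<length n. w s k (a ! k)) = (if a ! i = j then s else v i (a ! i)) * R" for s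
      unfolding split R_def by (auto simp: w_def intro!: arg_cong2[of _ _ _ _ "(*)"] prod.cong)
    have vR: "(\<Prod>k<length n. v k (a ! k)) = v i (a ! i) * R"
      unfolding split R_def ..
    show "Poly_Mapping.lookup (outer_product n v) a =
        Poly_Mapping.lookup ((1 - u) *\<^sub>R outer_product n (w (-1)) + u *\<^sub>R outer_product n (w 1)) a"
      by (auto simp: lookup_add lookup_outer_product wR vR u_def field_simps)
  qed
  also have "\<dots> \<in> convex hull (sign_tensors n)"
    using u by (intro convexD_alt[OF convex_convex_hull] w) auto
  finally show ?case .
qed

lemma nuclear_ball_inf:
  assumes n: "\<And>i. i < length n \<Longrightarrow> n ! i \<ge> 1"
  shows "nuclear_ball \<infinity> n = convex hull (sign_tensors n)"
proof
  show "nuclear_ball \<infinity> n \<subseteq> convex hull (sign_tensors n)"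
    unfolding nuclear_ball_def
  proof (rule hull_minimal, rule subsetI)
    fix x assume "x \<in> {outer_product n v | v. \<forall>i<length n. p_norm \<infinity> (n ! i) (v i) = 1}"
    then obtain v where v: "x = outer_product n v" "\<forall>i<length n. p_norm \<infinity> (n ! i) (v i) = 1"
        by blast
    have "finite (SIGMA i:{..<length n}. {1..n ! i})" by simp
    also have "(SIGMA i:{..<length n}. {1..n ! i}) = {(i, j). i < length n \<and> j \<in> {1..n ! i}}"
        by auto
    finally show "x \<in> convex hull (sign_tensors n)"
      unfolding v(1) using v(2) n
      by (intro outer_product_in_hull_sign_tensors[OF _ order_refl])
          (auto simp: p_norm_inf_eq_1_iff)
  qed simp
  have "sign_tensors n \<subseteq> {outer_product n v | v. \<forall>i<length n. p_norm \<infinity> (n ! i) (v i) = 1}"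
  proof -
    have "p_norm \<infinity> (n ! i) (v i) = 1"
      if "i < length n" "\<forall>i<length n. \<forall>j\<in>{1..n ! i}. \<bar>v i j\<bar> = 1" for v i
      using that n[OF that(1)] by (auto simp: p_norm_inf_eq_1_iff intro!: bexI[of _ 1])
    then show ?thesis unfolding sign_tensors_def by blast
  qed
  then show "convex hull (sign_tensors n) \<subseteq> nuclear_ball \<infinity> n"
    unfolding nuclear_ball_def by (rule hull_mono)
qed

lemma sign_tensors_square_sum:
  assumes "v \<in> sign_tensors n"
  shows "(\<Sum>a\<in>index_set n. (Poly_Mapping.lookup v a)\<^sup>2) = (\<Prod>i<length n. real (n ! i))"
proof -
  obtain w where w: "v = outer_product n w" "\<And>i j. \<lbrakk>i < length n; j \<in> {1..n ! i}\<rbrakk> \<Longrightarrow> \<bar>w i j\<bar> = 1"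
    using assms unfolding sign_tensors_def by blast
  have "(\<Sum>j=1..n ! i. (w i j)\<^sup>2) = real (n ! i)" if "i < length n" for i
  proof -
    have "(\<Sum>j=1..n ! i. (w i j)\<^sup>2) = (\<Sum>j=1..n ! i. 1)"
      using w(2)[OF that] by (intro sum.cong refl) (metis one_power2 power2_abs)
    then show ?thesis by simp
  qed
  then show ?thesis by (simp add: w(1) outer_product_square_sum)
qed

text \<open>
  The all-ones index is below every other index. Changing it in one position and taking meet and
  join with an index that is one from there on expresses the entry at a general index by the
  entries next to the all-ones index; these entries are the factors.
\<close>

lemma sign_tensor_if_meet_join:
  fixes x :: "nat list \<Rightarrow> real"
  assumes n: "n \<noteq> []" "\<And>i. i < length n \<Longrightarrow> n ! i \<ge> 1"
    and sign: "\<And>a. a \<in> index_set n \<Longrightarrow> \<bar>x a\<bar> = 1"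
    and rel: "\<And>a b. \<lbrakk>a \<in> index_set n; b \<in> index_set n\<rbrakk> \<Longrightarrow> x a * x b =
        x (index_meet a b) * x (index_join a b)"
  obtains v where "\<And>i j. \<lbrakk>i < length n; j \<in> {1..n ! i}\<rbrakk> \<Longrightarrow> \<bar>v i j\<bar> = 1"
    and "\<And>a. a \<in> index_set n \<Longrightarrow> x a = Poly_Mapping.lookup (outer_product n v) a"
proof -
  define o1 where "o1 = replicate (length n) (1::nat)"
  have o1: "o1 \<in> index_set n" using n(2) by (auto simp: o1_def index_set_def)
  have oo: "x o1 * x o1 = 1" using sign[OF o1] by (metis abs_mult_self_eq mult_1)
  define y where "y i j = x (o1[i := j])" for i j
  have y: "\<bar>y i j\<bar> = 1" if "j \<in> {1..n ! i}" for i j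
    unfolding y_def by (rule sign[OF index_set_update[OF o1 that]])
  have step: "x (take r a @ replicate (length n - r) 1) = x o1 * (\<Prod>i<r. x o1 * y i (a ! i))"
    if a: "a \<in> index_set n" and "r \<le> length n" for a r
    using \<open>r \<le> length n\<close>
  proof (induction r)
    case 0
    then show ?case by (simp add: o1_def)
  next
    case (Suc r)
    let ?t = "\<lambda>r. take r a @ replicate (length n - r) 1"
    let ?d = "o1[r := a ! r]"
    have len: "length a = length n" using index_setD(1)[OF a] .
    have t: "?t r \<in> index_set n" for r
      using index_setD[OF a] n(2) by (auto simp: index_set_def nth_append)
    have d: "?d \<in> index_set n" using Suc.prems
        by (intro index_set_update o1 index_setD(2)[OF a]) simp
    have "index_meet (?t r) ?d = o1"
    proof (rule nth_equalityI)
      show "length (index_meet (?t r) ?d) = length o1"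
        using index_setD(1)[OF t] index_setD(1)[OF d] by (simp add: index_meet_def o1_def)
      fix i assume "i < length (index_meet (?t r) ?d)"
      then have i: "i < length n" using index_setD(1)[OF t] by (simp add: index_meet_def)
      then have "1 \<le> a ! i" using index_setD(2)[OF a i] by simp
      then show "index_meet (?t r) ?d ! i = o1 ! i"
        using i len Suc.prems unfolding index_meet_join_nth(1)[OF t d i]
        by (simp add: nth_append o1_def nth_list_update)
    qed
    moreover have "index_join (?t r) ?d = ?t (Suc r)"
    proof (rule nth_equalityI)
      show "length (index_join (?t r) ?d) = length (?t (Suc r))"
        using index_setD(1)[OF t] index_setD(1)[OF d] by (simp add: index_join_def o1_def)
      fix i assume "i < length (index_join (?t r) ?d)"
      then have i: "i < length n" using index_setD(1)[OF t] by (simp add: index_join_def)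
      then have "1 \<le> a ! i" using index_setD(2)[OF a i] by simp
      then show "index_join (?t r) ?d ! i = ?t (Suc r) ! i"
        using i len Suc.prems unfolding index_meet_join_nth(2)[OF t d i]
        by (auto simp: nth_append o1_def nth_list_update less_Suc_eq)
    qed
    ultimately have "x (?t r) * y r (a ! r) = x o1 * x (?t (Suc r))"
      using rel[OF t d] by (simp add: y_def)
    then have "x o1 * (x o1 * x (?t (Suc r))) = x o1 * (x (?t r) * y r (a ! r))" by simp
    then have "x (?t (Suc r)) = x o1 * (x (?t r) * y r (a ! r))"
      by (simp add: mult.assoc[symmetric] oo)
    then show ?case using Suc by (simp add: mult_ac)
  qed
  \<comment> \<open>\<open>x o1\<close> is a sign; the copy of it in front of the product cancels the one in factor \<open>0\<close>\<close>
  define v where "v = (\<lambda>i j. x o1 * y i j)(0 := y 0)"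
  show ?thesis
  proof (rule that[of v])
    show "\<bar>v i j\<bar> = 1" if "i < length n" "j \<in> {1..n ! i}" for i j
      using y[OF that(2)] sign[OF o1] by (auto simp: v_def abs_mult)
    show "x a = Poly_Mapping.lookup (outer_product n v) a" if a: "a \<in> index_set n" for a
    proof -
      obtain l where l: "length n = Suc l" using n(1) by (cases n) auto
      have "x a = x o1 * (\<Prod>i<length n. x o1 * y i (a ! i))"
        using step[OF a, of "length n"] index_setD(1)[OF a] by simp
      also have "\<dots> = (x o1 * x o1) * (y 0 (a ! 0) * (\<Prod>i<l. x o1 * y (Suc i) (a ! Suc i)))"
        by (simp add: l prod.lessThan_Suc_shift del: prod.lessThan_Suc)
      also have "\<dots> = (\<Prod>i<length n. v i (a ! i))"
        by (simp add: l oo prod.lessThan_Suc_shift v_def del: prod.lessThan_Suc)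
      finally show ?thesis using a by (simp add: lookup_outer_product)
    qed
  qed
qed

text \<open>
  On the grid of signs the binomials force a tensor to have rank one, by
  \<open>sign_tensor_if_meet_join\<close>.
\<close>

lemma ideal_inf_eq_vanishing_ideal:
  assumes n: "n \<noteq> []" "\<And>i. i < length n \<Longrightarrow> n ! i \<ge> 1"
  shows "ideal_inf n = vanishing_ideal (index_set n) (sign_tensors n)"
  unfolding ideal_inf_def
proof (rule genideal_eq_vanishing_ideal)
  let ?A = "index_set n"
  let ?W = "vanishing_ideal ?A (sign_tensors n)"
  let ?G = "{var a ^ 2 - 1 | a. a \<in> ?A} \<union>
       {var a * var b - var (index_meet a b) * var (index_join a b) | a b. a \<in> ?A \<and> b \<in> ?A}"
  show G: "?G \<subseteq> ?W"
  proof -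
    have "var a ^ 2 - 1 \<in> ?W" if a: "a \<in> ?A" for a
    proof -
      have "(Poly_Mapping.lookup v a)\<^sup>2 = 1" if v: "v \<in> sign_tensors n" for v
      proof -
        obtain w where w: "v = outer_product n w"
            "\<And>i j. \<lbrakk>i < length n; j \<in> {1..n ! i}\<rbrakk> \<Longrightarrow> \<bar>w i j\<bar> = 1"
          using v unfolding sign_tensors_def by blast
        have "\<bar>Poly_Mapping.lookup v a\<bar> = (\<Prod>i<length n. \<bar>w i (a ! i)\<bar>)"
          using a by (simp add: w(1) lookup_outer_product abs_prod)
        also have "\<dots> = 1" using w(2) index_setD(2)[OF a] by (intro prod.neutral) simp
        finally show ?thesis by (metis one_power2 power2_abs)
      qed
      then show ?thesis using a
        by (auto simp: vanishing_ideal_def poly_hom_simps intro!: poly_ring_diff poly_ring_power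
            poly_ring_var poly_ring_one)
    qed
    moreover have "var a * var b - var (index_meet a b) * var (index_join a b) \<in> ?W"
        if ab: "a \<in> ?A" "b \<in> ?A" for a b
      using ab outer_product_meet_join[OF ab]
      by (auto simp: vanishing_ideal_def poly_hom_simps sign_tensors_def index_meet_join_closed
          intro!: poly_ring_diff poly_ring_mult poly_ring_var)
    ultimately show ?thesis by blast
  qed
  then have "?G \<subseteq> carrier (poly_ring ?A)"
    by (rule order_trans) (auto simp: vanishing_ideal_def)
  note I = ideal_genideal_poly_ring[OF this]
  fix f assume f: "f \<in> ?W"
  define L :: "real \<Rightarrow> nat list \<Rightarrow> nat list mpoly" where
    \<comment> \<open>Lagrange basis polynomials for the nodes \<open>-1, 1\<close>\<close>
    "L s a = (1 / 2) *\<^sub>R (1 + s *\<^sub>R var a)" for s a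
  show "f \<in> Idl\<^bsub>poly_ring ?A\<^esub> ?G"
  proof (rule grid_ideal_membership[OF I(1) finite_index_set, where S = "{-1, 1}" and L = L])
    show "L s a \<in> carrier (poly_ring ?A)" if "a \<in> ?A" for s a
      using that unfolding L_def
      by (intro poly_ring_scaleR poly_ring_add poly_ring_one poly_ring_var)
    show "(\<Sum>s\<in>{-1, 1}. L s a) = 1" for a
    proof -
      have "L (-1) a + L 1 a = (1 / 2) *\<^sub>R ((1 + (-1) *\<^sub>R var a) + (1 + 1 *\<^sub>R var a))"
        unfolding L_def by (simp only: scaleR_add_right)
      also have "(1 + (-1) *\<^sub>R var a) + (1 + 1 *\<^sub>R var a) = 2 *\<^sub>R (1 :: nat list mpoly)"
        by (simp add: scaleR_2)
      finally show ?thesis by simp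
    qed
    show "(var a - const s) * L s a \<in> Idl\<^bsub>poly_ring ?A\<^esub> ?G" if "s \<in> {-1, 1}" "a \<in> ?A" for s a
    proof -
      have *: "var a ^ 2 - 1 \<in> Idl\<^bsub>poly_ring ?A\<^esub> ?G" using I(2) that(2) by blast
      have "(var a - const s) * (1 + s *\<^sub>R var a) =
          s *\<^sub>R var a ^ 2 + ((1 - s * s) *\<^sub>R var a - const s)"
        by (simp add: algebra_simps const_mult power2_eq_square)
      also have "\<dots> = s *\<^sub>R (var a ^ 2 - 1)"
        using that(1) by (auto simp: scaleR_diff_right scaleR_one_mpoly[symmetric])
      finally have "(var a - const s) * L s a = (s / 2) *\<^sub>R (var a ^ 2 - 1)"
        by (simp add: L_def)
      then show ?thesis using ideal_poly_ring_scaleR[OF I(1) *] by simp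
    qed
    show "f \<in> carrier (poly_ring ?A)" using f by (simp add: vanishing_ideal_def)
  next
    fix x :: "nat list \<Rightarrow> real"
    assume x: "\<And>a. a \<in> ?A \<Longrightarrow> x a \<in> {-1, 1}" and h: "\<And>h. h \<in> Idl\<^bsub>poly_ring ?A\<^esub> ?G \<Longrightarrow> poly_hom x h = 0"
    have sign: "\<bar>x a\<bar> = 1" if "a \<in> ?A" for a using x[OF that] by auto
    have rel: "x a * x b = x (index_meet a b) * x (index_join a b)" if "a \<in> ?A" "b \<in> ?A" for a b
    proof -
      have "poly_hom x (var a * var b - var (index_meet a b) * var (index_join a b)) = 0"
        using that I(2) by (intro h) blast
      then show ?thesis by (simp add: poly_hom_simps)
    qed
    obtain v where v: "\<And>i j. \<lbrakk>i < length n; j \<in> {1..n ! i}\<rbrakk> \<Longrightarrow> \<bar>v i j\<bar> = 1"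
      "\<And>a. a \<in> ?A \<Longrightarrow> x a = Poly_Mapping.lookup (outer_product n v) a"
      using sign_tensor_if_meet_join[OF n sign rel] by blast
    have "outer_product n v \<in> sign_tensors n"
      unfolding sign_tensors_def using v(1) by blast
    then have "poly_hom (Poly_Mapping.lookup (outer_product n v)) f = 0"
      using f by (simp add: vanishing_ideal_def)
    moreover have "poly_hom x f = poly_hom (Poly_Mapping.lookup (outer_product n v)) f"
      using f v(2) by (intro poly_hom_cong[of f ?A]) (auto simp: vanishing_ideal_def)
    ultimately show "poly_hom x f = 0" by simp
  qed
qed

section \<open>Unit rank-one tensors\<close>

definition unit_rank_one :: "nat list \<Rightarrow> (nat list \<Rightarrow>\<^sub>0 real) set" where
  "unit_rank_one n = {outer_product n v | v. \<forall>i<length n. (\<Sum>j=1..n ! i. (v i j)\<^sup>2) = 1}"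

lemma nuclear_ball_2: "nuclear_ball 2 n = convex hull (unit_rank_one n)"
  by (simp add: nuclear_ball_def unit_rank_one_def p_norm_2_eq_1_iff)

lemma unit_rank_one_subset: "unit_rank_one n \<subseteq> vec_space (index_set n)"
  by (auto simp: unit_rank_one_def outer_product_in_vec_space)

lemma uminus_unit_rank_one:
  assumes "n \<noteq> []" "v \<in> unit_rank_one n"
  shows "- v \<in> unit_rank_one n"
proof -
  obtain w where w: "v = outer_product n w" "\<forall>i<length n. (\<Sum>j=1..n ! i. (w i j)\<^sup>2) = 1"
    using assms(2) unfolding unit_rank_one_def by blast
  have "\<forall>i<length n. (\<Sum>j=1..n ! i. ((w(0 := (\<lambda>j. - w 0 j))) i j)\<^sup>2) = 1" using w(2) by auto
  then show ?thesis
    unfolding unit_rank_one_def w(1) uminus_outer_product[OF assms(1)] by blast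
qed

lemma unit_rank_one_square_sum:
  assumes "v \<in> unit_rank_one n"
  shows "(\<Sum>a\<in>index_set n. (Poly_Mapping.lookup v a)\<^sup>2) = 1"
proof -
  obtain w where w: "v = outer_product n w" "\<forall>i<length n. (\<Sum>j=1..n ! i. (w i j)\<^sup>2) = 1"
    using assms unfolding unit_rank_one_def by blast
  then show ?thesis by (simp add: outer_product_square_sum)
qed

section \<open>Forms that vanish on rank-one tensors\<close>

text \<open>
  Dedekind's independence of characters, for functions on any set with a binary operation \<open>m\<close> and
  an element \<open>e\<close> on which they take the value one. A linear relation is made shorter by comparing
  its values at \<open>m u w\<close> with a multiple of its values at \<open>u\<close>.
\<close>

lemma characters_independent:
  fixes X :: "('u \<Rightarrow> real) set"
  assumes "finite X"
    and mult: "\<And>\<phi> u w. \<phi> \<in> X \<Longrightarrow> \<phi> (m u w) = \<phi> u * \<phi> w"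
    and unit: "\<And>\<phi>. \<phi> \<in> X \<Longrightarrow> \<phi> e = 1"
    and zero: "\<And>u. (\<Sum>\<phi>\<in>X. c \<phi> * \<phi> u) = 0"
    and "\<phi> \<in> X"
  shows "c \<phi> = 0"
  using assms
proof (induction X arbitrary: c \<phi> rule: finite_induct)
  case (insert \<phi>0 X)
  have X: "c \<phi> = 0" if "\<phi> \<in> X" for \<phi>
  proof -
    \<comment> \<open>the relation at \<open>m u w\<close> minus \<open>\<phi>0 w\<close> times the relation at \<open>u\<close> does not involve \<open>\<phi>0\<close>\<close>
    have "c \<phi> * (\<phi> w - \<phi>0 w) = 0" for w
    proof (rule insert.IH[where c = "\<lambda>\<phi>. c \<phi> * (\<phi> w - \<phi>0 w)"])
      fix u
      have sum: "(\<Sum>\<phi>\<in>X. c \<phi> * \<phi> u) = - (c \<phi>0 * \<phi>0 u)" for u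
        using insert.prems(3)[of u] insert.hyps by (simp add: eq_neg_iff_add_eq_0 add.commute)
      have "(\<Sum>\<phi>\<in>X. c \<phi> * (\<phi> w - \<phi>0 w) * \<phi> u) =
          (\<Sum>\<phi>\<in>X. c \<phi> * \<phi> (m u w)) - \<phi>0 w * (\<Sum>\<phi>\<in>X. c \<phi> * \<phi> u)"
        unfolding sum_distrib_left sum_subtractf[symmetric]
        using insert.prems(1) by (intro sum.cong) (auto simp: algebra_simps)
      also have "\<dots> = 0"
        using insert.prems(1)[of \<phi>0 u w] by (simp add: sum)
      finally show "(\<Sum>\<phi>\<in>X. c \<phi> * (\<phi> w - \<phi>0 w) * \<phi> u) = 0" .
    qed (use insert.prems that in auto)
    moreover have "\<phi> \<noteq> \<phi>0" using that insert.hyps by blast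
    then obtain w where "\<phi> w \<noteq> \<phi>0 w" by blast
    ultimately show ?thesis by (metis mult_eq_0_iff right_minus_eq)
  qed
  have "(\<Sum>\<phi>\<in>X. c \<phi> * \<phi> e) = 0" using X by (intro sum.neutral) simp
  then have "c \<phi>0 = 0"
    using insert.prems(2)[of \<phi>0] insert.prems(3)[of e] insert.hyps by simp
  then show ?case using X insert.prems(4) by blast
qed simp

text \<open>
  Monomials are indexed by multisets of variables, because the moves between monomials replace two
  of the factors and inductions run over the factors.
\<close>

definition multiset_monomial :: "'a multiset \<Rightarrow> 'a mpoly" where
  "multiset_monomial M = prod_mset (image_mset var M)"

lemma multiset_monomial_simps [simp]:
  "multiset_monomial {#} = 1"
  "multiset_monomial (add_mset a M) = var a * multiset_monomial M"
  by (simp_all add: multiset_monomial_def)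

lemma multiset_monomial_closed:
  "set_mset M \<subseteq> A \<Longrightarrow> multiset_monomial M \<in> carrier (poly_ring A)"
  by (induction M) (auto intro: poly_ring_one poly_ring_mult poly_ring_var)

lemma multiset_monomial_union:
    "multiset_monomial (M + N) = multiset_monomial M * multiset_monomial N"
  by (simp add: multiset_monomial_def)

lemma poly_hom_multiset_monomial: "poly_hom \<sigma> (multiset_monomial M) = prod_mset (image_mset \<sigma> M)"
  by (induction M) (auto simp: poly_hom_mult)

definition homogeneous :: "'a set \<Rightarrow> nat \<Rightarrow> 'a mpoly set" where
  "homogeneous A D = span {multiset_monomial M | M. set_mset M \<subseteq> A \<and> size M = D}"

lemma homogeneous_monomial: "set_mset M \<subseteq> A \<Longrightarrow> multiset_monomial M \<in> homogeneous A (size M)"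
  unfolding homogeneous_def by (intro span_base) blast

lemma subspace_homogeneous: "subspace (homogeneous A D)"
  by (simp add: homogeneous_def)

lemma homogeneous_induct [consumes 1, case_names monomial zero add scale]:
  assumes "f \<in> homogeneous A D"
    and "\<And>M. \<lbrakk>set_mset M \<subseteq> A; size M = D\<rbrakk> \<Longrightarrow> P (multiset_monomial M)"
    and "P 0" "\<And>f g. \<lbrakk>P f; P g\<rbrakk> \<Longrightarrow> P (f + g)" "\<And>c f. P f \<Longrightarrow> P (c *\<^sub>R f)"
  shows "P f"
proof -
  have "subspace {f. P f}" using assms(3-) by (auto simp: subspace_def)
  then show ?thesis
    using span_induct[of f "{multiset_monomial M | M. set_mset M \<subseteq> A \<and> size M = D}" P] assms(1,2)
    by (auto simp: homogeneous_def)
qed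

lemma homogeneous_subset: "f \<in> homogeneous A D \<Longrightarrow> f \<in> carrier (poly_ring A)"
  by (induction rule: homogeneous_induct)
     (auto intro: multiset_monomial_closed poly_ring_zero poly_ring_add poly_ring_scaleR)

lemma homogeneous_var_mult:
  assumes "f \<in> homogeneous A D" "a \<in> A"
  shows "var a * f \<in> homogeneous A (Suc D)"
  using assms(1)
proof (induction rule: homogeneous_induct)
  case (monomial M)
  then show ?case using homogeneous_monomial[of "add_mset a M" A] assms(2) by simp
qed (auto simp: distrib_left intro: subspace_homogeneous subspace_0 subspace_add subspace_scale)

lemma poly_hom_homogeneous:
  fixes x :: "'a \<Rightarrow> real"
  assumes "f \<in> homogeneous A D"
  shows "poly_hom (\<lambda>a. c * x a) f = c ^ D * poly_hom x f"
  using assms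
proof (induction rule: homogeneous_induct)
  case (monomial M)
  have "prod_mset (image_mset (\<lambda>a. c * x a) M) = c ^ size M * prod_mset (image_mset x M)" for M
    by (induction M) (auto simp: mult_ac)
  then show ?case using monomial by (simp add: poly_hom_multiset_monomial)
qed (auto simp: poly_hom_simps algebra_simps)

lemma poly_ring_span_monomials:
  assumes "f \<in> carrier (poly_ring A)"
  shows "f \<in> span {multiset_monomial M | M. set_mset M \<subseteq> A}"
proof -
  let ?S = "{multiset_monomial M | M. set_mset M \<subseteq> A}"
  have one: "1 \<in> ?S" by (auto intro!: exI[of _ "{#}"])
  have mult: "s * t \<in> ?S" if st: "s \<in> ?S" "t \<in> ?S" for s t
  proof -
    obtain M N where "s = multiset_monomial M" "t = multiset_monomial N" "set_mset M \<subseteq> A"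
        "set_mset N \<subseteq> A"
      using st by blast
    then show ?thesis by (auto simp: multiset_monomial_union[symmetric] intro!: exI[of _ "M + N"])
  qed
  have v: "var a \<in> ?S" if "a \<in> A" for a
    using that by (auto intro!: exI[of _ "{#a#}"])
  have pow: "s ^ k \<in> ?S" if "s \<in> ?S" for s k
    by (induction k) (simp_all only: power_0 power_Suc one mult that)
  have prod: "(\<Prod>a\<in>B. g a) \<in> ?S" if "\<And>a. a \<in> B \<Longrightarrow> g a \<in> ?S" for B and g :: "'a \<Rightarrow> 'a mpoly"
    using that
  proof (induction B rule: infinite_finite_induct)
    case (insert b B)
    have "g b * (\<Prod>a\<in>B. g a) \<in> ?S"
      by (rule mult) (use insert in blast)+
    then show ?case using insert.hyps by simp
  next
    case (infinite B)
    then have "(\<Prod>a\<in>B. g a) = 1" by simp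
    then show ?case using one by (simp only:)
  qed (simp only: prod.empty one)
  have "monomial_value var m \<in> ?S" if "m \<in> Poly_Mapping.keys f" for m
    unfolding monomial_value_def using that assms
    by (intro prod pow v) (auto simp: mem_poly_ring)
  then have "poly_hom var f \<in> span ?S"
    unfolding poly_hom_def by (intro span_sum span_scale span_base) blast
  then show ?thesis by (simp add: poly_hom_var_id)
qed

text \<open>
  Multiplying a form by the sum of the squares of the variables raises its degree by two and does
  not change its class, so all homogeneous parts of even degree can be brought to a common degree,
  and likewise those of odd degree.
\<close>

lemma parity_homogenization:
  assumes I: "ideal I (poly_ring A)" and sphere: "(\<Sum>a\<in>A. var a ^ 2) - 1 \<in> I"
    and f: "f \<in> carrier (poly_ring A)"
  obtains D G H where "G \<in> homogeneous A (2 * D)" "H \<in> homogeneous A (2 * D + 1)" "f - (G + H) \<in> I"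
proof -
  note cl = ideal_poly_ring_closed[OF I]
  have raise2: "\<exists>G'\<in>homogeneous A (D + 2). G - G' \<in> I" if G: "G \<in> homogeneous A D" for G D
  proof
    show "(\<Sum>a\<in>A. var a ^ 2) * G \<in> homogeneous A (D + 2)"
      unfolding sum_distrib_right power2_eq_square mult.assoc
      using homogeneous_var_mult[OF homogeneous_var_mult[OF G]]
      by (intro subspace_sum[OF subspace_homogeneous]) simp
    have "- (G * ((\<Sum>a\<in>A. var a ^ 2) - 1)) \<in> I"
      by (intro cl(6) cl(4) homogeneous_subset[OF G] sphere)
    then show "G - (\<Sum>a\<in>A. var a ^ 2) * G \<in> I" by (simp add: algebra_simps)
  qed
  have raise: "\<exists>G'\<in>homogeneous A (D + 2 * j). G - G' \<in> I" if G: "G \<in> homogeneous A D" for G D j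
  proof (induction j)
    case 0
    then show ?case using G cl(2) by (intro bexI[of _ G]) auto
  next
    case (Suc j)
    then obtain G' where G': "G' \<in> homogeneous A (D + 2 * j)" "G - G' \<in> I" by blast
    obtain G'' where "G'' \<in> homogeneous A (D + 2 * j + 2)" "G' - G'' \<in> I" using raise2[OF G'(1)]
        by blast
    then show ?case using cl(3)[OF G'(2), of "G' - G''"] by (intro bexI[of _ G'']) auto
  qed
  define P where "P f \<longleftrightarrow> (\<exists>D G H. G \<in> homogeneous A (2 * D) \<and> H \<in> homogeneous A (2 * D + 1) \<and>
      f - (G + H) \<in> I)" for f
  note sub = subspace_0[OF subspace_homogeneous] subspace_add[OF subspace_homogeneous]
      subspace_scale[OF subspace_homogeneous]
  have mono: "P (multiset_monomial M)" if "set_mset M \<subseteq> A" for M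
  proof (cases "even (size M)")
    case True
    then have "multiset_monomial M \<in> homogeneous A (2 * (size M div 2))"
      using homogeneous_monomial[OF that] by simp
    then show ?thesis unfolding P_def using sub(1) cl(2)
      by (intro exI[of _ "size M div 2"] exI[of _ "multiset_monomial M"] exI[of _ 0]) simp
  next
    case False
    then have "multiset_monomial M \<in> homogeneous A (2 * (size M div 2) + 1)"
      using homogeneous_monomial[OF that] by simp
    then show ?thesis unfolding P_def using sub(1) cl(2)
      by (intro exI[of _ "size M div 2"] exI[of _ 0] exI[of _ "multiset_monomial M"]) simp
  qed
  have add: "P (f + g)" if "P f" "P g" for f g
  proof -
    obtain D G H where 1: "G \<in> homogeneous A (2 * D)" "H \<in> homogeneous A (2 * D + 1)"
        "f - (G + H) \<in> I"
      using \<open>P f\<close> unfolding P_def by blast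
    obtain D' G' H' where 2: "G' \<in> homogeneous A (2 * D')" "H' \<in> homogeneous A (2 * D' + 1)"
        "g - (G' + H') \<in> I"
      using \<open>P g\<close> unfolding P_def by blast
    have e: "2 * D + 2 * D' = 2 * (D + D')" "2 * D' + 2 * D = 2 * (D + D')"
      "2 * D + 1 + 2 * D' = 2 * (D + D') + 1" "2 * D' + 1 + 2 * D = 2 * (D + D') + 1" by auto
    obtain G1 H1 where 3: "G1 \<in> homogeneous A (2 * (D + D'))" "G - G1 \<in> I"
        "H1 \<in> homogeneous A (2 * (D + D') + 1)" "H - H1 \<in> I"
      using raise[OF 1(1), of D'] raise[OF 1(2), of D'] unfolding e by blast
    obtain G2 H2 where 4: "G2 \<in> homogeneous A (2 * (D + D'))" "G' - G2 \<in> I"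
        "H2 \<in> homogeneous A (2 * (D + D') + 1)" "H' - H2 \<in> I"
      using raise[OF 2(1), of D] raise[OF 2(2), of D] unfolding e by blast
    have "f + g - ((G1 + G2) + (H1 + H2)) =
        ((f - (G + H)) + (g - (G' + H'))) +
            (((G - G1) + (H - H1)) + ((G' - G2) + (H' - H2)))" by simp
    also have "\<dots> \<in> I" by (intro cl(3) 1 2 3 4)
    finally show ?thesis unfolding P_def using sub(2) 3 4 by blast
  qed
  have scale: "P (c *\<^sub>R f)" if "P f" for c f
  proof -
    obtain D G H where 1: "G \<in> homogeneous A (2 * D)" "H \<in> homogeneous A (2 * D + 1)"
        "f - (G + H) \<in> I"
      using \<open>P f\<close> unfolding P_def by blast
    have "c *\<^sub>R f - (c *\<^sub>R G + c *\<^sub>R H) = c *\<^sub>R (f - (G + H))" by (simp add: algebra_simps)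
    also have "\<dots> \<in> I" by (intro cl(5) 1)
    finally show ?thesis unfolding P_def using sub(3) 1 by blast
  qed
  have "P f"
  proof (rule span_induct[OF poly_ring_span_monomials[OF f], of P])
    show "subspace {f. P f}"
      using mono[of "{#}"] scale[of 1 0] add scale by (auto simp: subspace_def) 
  qed (use mono in auto)
  then show ?thesis using that unfolding P_def by blast
qed

text \<open>
  Exchanging the entries of two indices in one position changes neither their meet nor their join.
\<close>

lemma toric_swap:
  assumes rel: "\<And>a b. \<lbrakk>a \<in> index_set n; b \<in> index_set n\<rbrakk> \<Longrightarrow>
      var a * var b - var (index_meet a b) * var (index_join a b) \<in> I"
    and I: "ideal I (poly_ring (index_set n))"
    and ab: "a \<in> index_set n" "b \<in> index_set n" and i: "i < length n"
  shows "var a * var b - var (a[i := b ! i]) * var (b[i := a ! i]) \<in> I"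
proof -
  let ?a = "a[i := b ! i]" and ?b = "b[i := a ! i]"
  have ab': "?a \<in> index_set n" "?b \<in> index_set n"
    using index_setD(2)[OF ab(1) i] index_setD(2)[OF ab(2) i] ab by (auto intro: index_set_update)
  note len = index_setD(1)[OF ab(1)] index_setD(1)[OF ab(2)]
  have "index_meet ?a ?b = index_meet a b" "index_join ?a ?b = index_join a b"
    by (auto intro!: nth_equalityI simp: index_meet_def index_join_def len nth_list_update i)
  then have "var ?a * var ?b - var (index_meet a b) * var (index_join a b) \<in> I"
    using rel[OF ab'] by simp
  from ideal_poly_ring_diff[OF I rel[OF ab] this] show ?thesis by simp
qed

text \<open>
  If every coordinate of \<open>b\<close> occurs among the indices of \<open>M\<close>, then swaps build up \<open>b\<close> in one of
  the factors, coordinate by coordinate. Swaps do not change the multisets of coordinates, so the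
  next coordinate of \<open>b\<close> is still available.
\<close>

lemma toric_exchange:
  assumes rel: "\<And>a b. \<lbrakk>a \<in> index_set n; b \<in> index_set n\<rbrakk> \<Longrightarrow>
      var a * var b - var (index_meet a b) * var (index_join a b) \<in> I"
    and I: "ideal I (poly_ring (index_set n))"
    and M: "set_mset M \<subseteq> index_set n" "M \<noteq> {#}"
    and b: "\<And>i. i < length n \<Longrightarrow> b ! i \<in># image_mset (\<lambda>a. a ! i) M"
    and r: "r \<le> length n"
  shows "\<exists>a M'. set_mset (add_mset a M') \<subseteq> index_set n \<and> size (add_mset a M') = size M \<and>
    (\<forall>i<r. a ! i = b ! i) \<and> multiset_monomial M - multiset_monomial (add_mset a M') \<in> I \<and>
    (\<forall>i<length n. image_mset (\<lambda>c. c ! i) (add_mset a M') = image_mset (\<lambda>c. c ! i) M)"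
  using r
proof (induction r)
  case 0
  obtain a M' where "M = add_mset a M'" using M(2) by (metis multiset_cases)
  then show ?case using M ideal_poly_ring_zero[OF I] by (intro exI[of _ a] exI[of _ M']) auto
next
  case (Suc r)
  then obtain a M' where a: "set_mset (add_mset a M') \<subseteq> index_set n" "size (add_mset a M') = size M"
    "\<forall>i<r. a ! i = b ! i" "multiset_monomial M - multiset_monomial (add_mset a M') \<in> I"
    "\<forall>i<length n. image_mset (\<lambda>c. c ! i) (add_mset a M') = image_mset (\<lambda>c. c ! i) M" by auto
  show ?case
  proof (cases "a ! r = b ! r")
    case True
    then show ?thesis using a by (intro exI[of _ a] exI[of _ M']) (auto simp: less_Suc_eq)
  next
    case False
    have r: "r < length n" using Suc.prems by simp
    have "b ! r \<in># image_mset (\<lambda>c. c ! r) (add_mset a M')" using b[OF r] a(5) r by simp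
    then obtain c where "c \<in># M'" "c ! r = b ! r" using False by auto
    then obtain M'' where c: "M' = add_mset c M''" "c ! r = b ! r" by (metis mset_add)
    have ac: "a \<in> index_set n" "c \<in> index_set n" using a(1) c by auto
    note len = index_setD(1)[OF ac(1)] index_setD(1)[OF ac(2)]
    let ?a = "a[r := c ! r]" and ?c = "c[r := a ! r]"
    have ac': "?a \<in> index_set n" "?c \<in> index_set n"
      using index_setD(2)[OF ac(1) r] index_setD(2)[OF ac(2) r] ac by (auto intro: index_set_update)
    have M'': "multiset_monomial M'' \<in> carrier (poly_ring (index_set n))"
      using a(1) c by (intro multiset_monomial_closed) auto
    have "multiset_monomial M - multiset_monomial (add_mset ?a (add_mset ?c M'')) =
        (multiset_monomial M - multiset_monomial (add_mset a M')) +
        multiset_monomial M'' * (var a * var c - var ?a * var ?c)"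
      by (simp add: c(1) algebra_simps)
    also have "\<dots> \<in> I"
      by (intro ideal_poly_ring_add[OF I] a(4) ideal_poly_ring_mult[OF I] M''
          toric_swap[OF rel I ac r])
    finally have 1: "multiset_monomial M - multiset_monomial (add_mset ?a (add_mset ?c M'')) \<in> I" .
    have 2: "image_mset (\<lambda>c. c ! i) (add_mset ?a (add_mset ?c M'')) = image_mset (\<lambda>c. c ! i) M"
      if i: "i < length n" for i
      using a(5)[rule_format, OF i] r by (cases "i = r") (auto simp: c(1) len add_mset_commute)
    show ?thesis
      using 1 2 a(1,2,3) c ac' r
      by (intro exI[of _ ?a] exI[of _ "add_mset ?c M''"]) (auto simp: less_Suc_eq len)
  qed
qed

text \<open>
  Two monomials with the same multiset of coordinates in each position are congruent: by
  \<open>toric_exchange\<close> a factor of the second can be produced in the first and split off.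
\<close>

lemma toric_congruence:
  assumes rel: "\<And>a b. \<lbrakk>a \<in> index_set n; b \<in> index_set n\<rbrakk> \<Longrightarrow>
      var a * var b - var (index_meet a b) * var (index_join a b) \<in> I"
    and I: "ideal I (poly_ring (index_set n))"
    and "set_mset M \<subseteq> index_set n" "set_mset N \<subseteq> index_set n" "size M = size N"
    and "\<And>i. i < length n \<Longrightarrow> image_mset (\<lambda>a. a ! i) M = image_mset (\<lambda>a. a ! i) N"
  shows "multiset_monomial M - multiset_monomial N \<in> I"
  using assms(3-)
proof (induction N arbitrary: M)
  case empty
  then show ?case using ideal_poly_ring_zero[OF I] by simp
next
  case (add b N)
  have "\<exists>a M'. set_mset (add_mset a M') \<subseteq> index_set n \<and> size (add_mset a M') = size M \<and>
    (\<forall>i<length n. a ! i = b ! i) \<and> multiset_monomial M - multiset_monomial (add_mset a M') \<in> I \<and>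
    (\<forall>i<length n. image_mset (\<lambda>c. c ! i) (add_mset a M') = image_mset (\<lambda>c. c ! i) M)"
    using add.prems by (intro toric_exchange[OF rel I]) auto
  then obtain a M' where a: "set_mset (add_mset a M') \<subseteq> index_set n" "size (add_mset a M') = size M"
    "\<forall>i<length n. a ! i = b ! i" "multiset_monomial M - multiset_monomial (add_mset a M') \<in> I"
    "\<forall>i<length n. image_mset (\<lambda>c. c ! i) (add_mset a M') = image_mset (\<lambda>c. c ! i) M" by blast
  have ab: "a = b"
    using a(1,3) add.prems(2) index_setD(1)[of a n] index_setD(1)[of b n]
        by (intro nth_equalityI) auto
  have "multiset_monomial M' - multiset_monomial N \<in> I"
  proof (rule add.IH)
    fix i assume i: "i < length n"
    show "image_mset (\<lambda>a. a ! i) M' = image_mset (\<lambda>a. a ! i) N"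
      using a(5)[rule_format, OF i] add.prems(4)[OF i] ab by simp
  qed (use a add.prems in auto)
  then have "var b * (multiset_monomial M' - multiset_monomial N) \<in> I"
    using add.prems by (intro ideal_poly_ring_mult[OF I] poly_ring_var) auto
  from ideal_poly_ring_add[OF I a(4) this] show ?case by (simp add: ab algebra_simps)
qed

lemma prod_mset_power_count:
  "prod_mset (image_mset (\<lambda>a. if g a = j then 2 else 1 :: real) M) = 2 ^ count (image_mset g M) j"
  by (induction M) auto

text \<open>
  The multiplicity of the coordinate \<open>j\<close> in position \<open>i\<close> is read off by evaluating at the rank-one
  tensor with entry \<open>2\<close> there and \<open>1\<close> elsewhere.
\<close>

lemma margins_eq_if_characters_eq:
  assumes MN: "set_mset M \<subseteq> index_set n" "set_mset N \<subseteq> index_set n"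
    and eq: "\<And>u. poly_hom (Poly_Mapping.lookup (outer_product n u)) (multiset_monomial M) =
      poly_hom (Poly_Mapping.lookup (outer_product n u)) (multiset_monomial N)"
    and i: "i < length n"
  shows "image_mset (\<lambda>a. a ! i) M = image_mset (\<lambda>a. a ! i) N"
proof (rule multiset_eqI)
  fix j
  define u :: "nat \<Rightarrow> nat \<Rightarrow> real" where "u i' j' = (if i' = i \<and> j' = j then 2 else 1)" for i' j'
  have "Poly_Mapping.lookup (outer_product n u) a = (if a ! i = j then 2 else 1)"
      if "a \<in> index_set n" for a
  proof -
    have "(\<Prod>i'<length n. u i' (a ! i')) =
        (\<Prod>i'<length n. if i' = i then (if a ! i = j then 2 else 1) else 1)"
      by (rule prod.cong) (auto simp: u_def)
    also have "\<dots> = (if a ! i = j then 2 else 1)" using i by (simp add: prod.delta)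
    finally show ?thesis using that by (simp add: lookup_outer_product)
  qed
  then have "poly_hom (Poly_Mapping.lookup (outer_product n u)) (multiset_monomial K) =
      2 ^ count (image_mset (\<lambda>a. a ! i) K) j" if "set_mset K \<subseteq> index_set n" for K
    unfolding poly_hom_multiset_monomial prod_mset_power_count[symmetric] using that
    by (intro arg_cong[of _ _ prod_mset] image_mset_cong) auto
  from this[OF MN(1)] this[OF MN(2)] eq[of u]
  show "count (image_mset (\<lambda>a. a ! i) M) j = count (image_mset (\<lambda>a. a ! i) N) j" by simp
qed

text \<open>
  The monomials of a form are grouped by the functions that they define on rank-one tensors.
  Independence of characters makes the coefficients of each group sum to zero, and the monomials
  of a group are congruent modulo \<open>I\<close>.
\<close>

lemma homogeneous_in_toric_ideal:
  assumes rel: "\<And>a b. \<lbrakk>a \<in> index_set n; b \<in> index_set n\<rbrakk> \<Longrightarrow>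
      var a * var b - var (index_meet a b) * var (index_join a b) \<in> I"
    and I: "ideal I (poly_ring (index_set n))"
    and F: "F \<in> homogeneous (index_set n) D"
    and vanish: "\<And>u. poly_hom (Poly_Mapping.lookup (outer_product n u)) F = 0"
  shows "F \<in> I"
proof -
  define ev where "ev t u = poly_hom (Poly_Mapping.lookup (outer_product n u)) t" for t u
  obtain T r where T: "finite T"
      "T \<subseteq> {multiset_monomial M | M. set_mset M \<subseteq> index_set n \<and> size M = D}"
    "F = (\<Sum>t\<in>T. r t *\<^sub>R t)"
    using F unfolding homogeneous_def span_explicit by blast
  have cong: "t - t' \<in> I" if t: "t \<in> T" "t' \<in> T" "ev t = ev t'" for t t'
  proof -
    obtain M N where MN: "t = multiset_monomial M" "set_mset M \<subseteq> index_set n" "size M = D"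
      "t' = multiset_monomial N" "set_mset N \<subseteq> index_set n" "size N = D" using t(1,2) T(2) by blast
    have "image_mset (\<lambda>a. a ! i) M = image_mset (\<lambda>a. a ! i) N" if "i < length n" for i
      using t(3) that by (intro margins_eq_if_characters_eq MN) (auto simp: ev_def MN fun_eq_iff)
    then show ?thesis unfolding MN using MN by (intro toric_congruence[OF rel I]) auto
  qed
  define C where "C \<phi> = (\<Sum>t | t \<in> T \<and> ev t = \<phi>. r t)" for \<phi>
  have C0: "C \<phi> = 0" if "\<phi> \<in> ev ` T" for \<phi>
  proof (rule characters_independent[where X = "ev ` T" and c = C and \<phi> = \<phi>
      and m = "\<lambda>u w i j. u i j * w i j" and e = "\<lambda>i j. 1"])
    fix \<phi> u w assume "\<phi> \<in> ev ` T"
    then obtain M where M: "\<phi> = ev (multiset_monomial M)" "set_mset M \<subseteq> index_set n" using T(2)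
        by blast
    show "\<phi> (\<lambda>i j. u i j * w i j) = \<phi> u * \<phi> w"
      using M(2) unfolding M(1) ev_def poly_hom_multiset_monomial
      by (induction M) (auto simp: lookup_outer_product prod.distrib)
  next
    fix \<phi> assume "\<phi> \<in> ev ` T"
    then obtain M where M: "\<phi> = ev (multiset_monomial M)" "set_mset M \<subseteq> index_set n" using T(2)
        by blast
    show "\<phi> (\<lambda>i j. 1) = 1"
      using M(2) unfolding M(1) ev_def poly_hom_multiset_monomial
      by (induction M) (auto simp: lookup_outer_product)
  next
    fix u
    have "0 = (\<Sum>t\<in>T. r t * ev t u)"
      using vanish[of u] by (simp add: T(3) poly_hom_simps ev_def)
    also have "\<dots> = (\<Sum>\<phi>\<in>ev ` T. \<Sum>t | t \<in> T \<and> ev t = \<phi>. r t * ev t u)"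
      by (rule sum.image_gen[OF T(1)])
    also have "\<dots> = (\<Sum>\<phi>\<in>ev ` T. C \<phi> * \<phi> u)"
      unfolding C_def sum_distrib_right by (intro sum.cong refl) auto
    finally show "(\<Sum>\<phi>\<in>ev ` T. C \<phi> * \<phi> u) = 0" by simp
  qed (use T(1) that in auto)
  have "F = (\<Sum>\<phi>\<in>ev ` T. \<Sum>t | t \<in> T \<and> ev t = \<phi>. r t *\<^sub>R t)"
    unfolding T(3) by (rule sum.image_gen[OF T(1)])
  also have "\<dots> \<in> I"
  proof (rule ideal_poly_ring_sum[OF I])
    fix \<phi> assume \<phi>: "\<phi> \<in> ev ` T"
    then obtain t0 where t0: "t0 \<in> T" "\<phi> = ev t0" by blast
    have "(\<Sum>t | t \<in> T \<and> ev t = \<phi>. r t *\<^sub>R t) =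
        (\<Sum>t | t \<in> T \<and> ev t = \<phi>. r t *\<^sub>R (t - t0)) + C \<phi> *\<^sub>R t0"
      by (simp add: C_def scaleR_sum_left sum.distrib[symmetric] scaleR_diff_right)
    also have "\<dots> = (\<Sum>t | t \<in> T \<and> ev t = \<phi>. r t *\<^sub>R (t - t0))" using C0[OF \<phi>] by simp
    also have "\<dots> \<in> I"
      by (intro ideal_poly_ring_sum[OF I] ideal_poly_ring_scaleR[OF I] cong) (use t0 in auto)
    finally show "(\<Sum>t | t \<in> T \<and> ev t = \<phi>. r t *\<^sub>R t) \<in> I" .
  qed
  finally show ?thesis .
qed

text \<open>
  The scalar \<open>c\<close> may be zero: a zero factor is replaced by a coordinate vector, which exists
  because every dimension is positive.
\<close>

lemma outer_product_normalize:
  assumes n: "\<And>i. i < length n \<Longrightarrow> n ! i \<ge> 1"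
  obtains v c where "\<forall>i<length n. (\<Sum>j=1..n ! i. (v i j)\<^sup>2) = 1"
    "outer_product n u = c *\<^sub>R outer_product n v"
proof -
  have "\<exists>w c. (\<Sum>j=1..n ! i. (w j)\<^sup>2) = 1 \<and> (\<forall>j\<in>{1..n ! i}. u i j = c * w j)" if i: "i < length n"
      for i
  proof (cases "\<forall>j\<in>{1..n ! i}. u i j = 0")
    case True
    have "(\<Sum>j=1..n ! i. (if j = 1 then 1 else 0 :: real)\<^sup>2) = 1"
      using n[OF i] by (simp add: if_distrib[of "\<lambda>x. x\<^sup>2"] sum.delta cong: if_cong)
    then show ?thesis using True by (intro exI[of _ "\<lambda>j. if j = 1 then 1 else 0"] exI[of _ 0]) auto
  next
    case False
    then obtain j where j: "j \<in> {1..n ! i}" "u i j \<noteq> 0" by blast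
    define s where "s = (\<Sum>j=1..n ! i. (u i j)\<^sup>2)"
    have "s > 0" unfolding s_def using j by (intro sum_pos2[of _ j]) auto
    then have "(\<Sum>j=1..n ! i. (u i j / sqrt s)\<^sup>2) = 1"
      by (simp add: power_divide sum_divide_distrib[symmetric]) (simp add: s_def)
    then show ?thesis using \<open>s > 0\<close>
        by (intro exI[of _ "\<lambda>j. u i j / sqrt s"] exI[of _ "sqrt s"]) auto
  qed
  then obtain v c where vc: "\<And>i. i < length n \<Longrightarrow> (\<Sum>j=1..n ! i. (v i j)\<^sup>2) = 1"
    "\<And>i j. \<lbrakk>i < length n; j \<in> {1..n ! i}\<rbrakk> \<Longrightarrow> u i j = c i * v i j"
    by metis
  show ?thesis
  proof (rule that[of v "\<Prod>i<length n. c i"])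
    show "outer_product n u = (\<Prod>i<length n. c i) *\<^sub>R outer_product n v"
    proof (rule poly_mapping_eqI)
      fix a
      have "(\<Prod>i<length n. u i (a ! i)) = (\<Prod>i<length n. c i * v i (a ! i))" if "a \<in> index_set n"
        using index_setD(2)[OF that] by (intro prod.cong refl vc(2)) auto
      then show "Poly_Mapping.lookup (outer_product n u) a =
          Poly_Mapping.lookup ((\<Prod>i<length n. c i) *\<^sub>R outer_product n v) a"
        by (simp add: lookup_outer_product prod.distrib)
    qed
  qed (use vc(1) in blast)
qed

section \<open>The case p = 2\<close>

text \<open>
  After homogenisation \<open>f\<close> is congruent to \<open>P + Q\<close> with forms of even and odd degree. Evaluating
  at a unit rank-one tensor and at its negative gives \<open>P + Q = 0\<close> and \<open>P - Q = 0\<close>. By homogeneity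
  both vanish on all rank-one tensors and hence lie in the ideal.
\<close>

lemma ideal_2_eq_vanishing_ideal:
  assumes n: "n \<noteq> []" "\<And>i. i < length n \<Longrightarrow> n ! i \<ge> 1"
  shows "ideal_2 n = vanishing_ideal (index_set n) (unit_rank_one n)"
  unfolding ideal_2_def
proof (rule genideal_eq_vanishing_ideal)
  let ?A = "index_set n"
  let ?W = "vanishing_ideal ?A (unit_rank_one n)"
  let ?G = "{(\<Sum>a\<in>?A. var a ^ 2) - 1} \<union>
       {var a * var b - var (index_meet a b) * var (index_join a b) | a b. a \<in> ?A \<and> b \<in> ?A}"
  let ?I = "Idl\<^bsub>poly_ring ?A\<^esub> ?G"
  show G: "?G \<subseteq> ?W"
  proof -
    have "(\<Sum>a\<in>?A. var a ^ 2) - 1 \<in> ?W"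
      using unit_rank_one_square_sum
      by (auto simp: vanishing_ideal_def poly_hom_simps
          intro!: poly_ring_diff poly_ring_sum poly_ring_power poly_ring_var poly_ring_one)
    moreover have "var a * var b - var (index_meet a b) * var (index_join a b) \<in> ?W"
        if ab: "a \<in> ?A" "b \<in> ?A" for a b
      using ab outer_product_meet_join[OF ab]
      by (auto simp: vanishing_ideal_def poly_hom_simps unit_rank_one_def index_meet_join_closed
          intro!: poly_ring_diff poly_ring_mult poly_ring_var)
    ultimately show ?thesis by blast
  qed
  then have "?G \<subseteq> carrier (poly_ring ?A)"
    by (rule order_trans) (auto simp: vanishing_ideal_def)
  note I = ideal_genideal_poly_ring[OF this]
  have IW: "?I \<subseteq> ?W"
    by (rule ring.genideal_minimal[OF cring_poly_ring[THEN cring.axioms(1)] ideal_vanishing_ideal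
        G])
  have rel: "var a * var b - var (index_meet a b) * var (index_join a b) \<in> ?I"
      if "a \<in> ?A" "b \<in> ?A" for a b
    using that I(2) by blast
  have sphere: "(\<Sum>a\<in>?A. var a ^ 2) - 1 \<in> ?I" using I(2) by blast
  fix f assume f: "f \<in> ?W"
  then have fc: "f \<in> carrier (poly_ring ?A)" by (simp add: vanishing_ideal_def)
  obtain D P Q where PQ: "P \<in> homogeneous ?A (2 * D)" "Q \<in> homogeneous ?A (2 * D + 1)"
      "f - (P + Q) \<in> ?I"
    using parity_homogenization[OF I(1) sphere fc] by blast
  have zero: "poly_hom (Poly_Mapping.lookup x) P + poly_hom (Poly_Mapping.lookup x) Q = 0"
    if x: "x \<in> unit_rank_one n" for x
  proof -
    have "poly_hom (Poly_Mapping.lookup x) (f - (P + Q)) = 0"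
      using subsetD[OF IW PQ(3)] x by (simp add: vanishing_ideal_def)
    moreover have "poly_hom (Poly_Mapping.lookup x) f = 0" using f x
        by (simp add: vanishing_ideal_def)
    ultimately show ?thesis by (simp add: poly_hom_simps)
  qed
  have PQ0: "poly_hom (Poly_Mapping.lookup (outer_product n v)) P = 0 \<and>
      poly_hom (Poly_Mapping.lookup (outer_product n v)) Q = 0"
    if v: "\<forall>i<length n. (\<Sum>j=1..n ! i. (v i j)\<^sup>2) = 1" for v
  proof -
    have mem: "outer_product n v \<in> unit_rank_one n" using v unfolding unit_rank_one_def by blast
    note plus = zero[OF mem]
    note minus = zero[OF uminus_unit_rank_one[OF n(1) mem]]
    have neg: "Poly_Mapping.lookup (- outer_product n v) =
        (\<lambda>a. (-1) * Poly_Mapping.lookup (outer_product n v) a)"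
      by (simp add: fun_eq_iff)
    show ?thesis using plus minus
        unfolding neg poly_hom_homogeneous[OF PQ(1)] poly_hom_homogeneous[OF PQ(2)] by simp
  qed
  have PQu: "poly_hom (Poly_Mapping.lookup (outer_product n u)) P = 0 \<and>
      poly_hom (Poly_Mapping.lookup (outer_product n u)) Q = 0" for u
  proof -
    obtain v c where v: "\<forall>i<length n. (\<Sum>j=1..n ! i. (v i j)\<^sup>2) = 1"
        "outer_product n u = c *\<^sub>R outer_product n v"
      using outer_product_normalize[OF n(2)] by blast
    have scale: "Poly_Mapping.lookup (outer_product n u) =
        (\<lambda>a. c * Poly_Mapping.lookup (outer_product n v) a)"
      by (simp add: v(2) fun_eq_iff)
    show ?thesis using PQ0[OF v(1)]
      unfolding scale poly_hom_homogeneous[OF PQ(1)] poly_hom_homogeneous[OF PQ(2)] by simp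
  qed
  have "P \<in> ?I"
    by (rule homogeneous_in_toric_ideal[OF rel I(1) PQ(1)]) (use PQu in auto)
  moreover have "Q \<in> ?I"
    by (rule homogeneous_in_toric_ideal[OF rel I(1) PQ(2)]) (use PQu in auto)
  ultimately have "(f - (P + Q)) + (P + Q) \<in> ?I" by (intro ideal_poly_ring_add[OF I(1)] PQ(3))
  then show "f \<in> ?I" by simp
qed

section \<open>Symmetry of the theta bodies\<close>

theorem theorem1:
  fixes p :: enat and d k :: nat and n :: "nat list"
  assumes "p \<in> {1, 2, \<infinity>}"
    and "d \<ge> 1" and "length n = d" and "\<forall>i<d. n ! i \<ge> 1"
    and "k \<ge> 1"
  shows "(\<forall>g. linear_automorphism_on (vec_space (index_set n)) g \<and>
               g ` nuclear_ball p n = nuclear_ball p n \<longrightarrow>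
               g ` theta_body (index_set n) (nuclear_ideal p n) k =
                 theta_body (index_set n) (nuclear_ideal p n) k) \<and>
         (\<exists>N. norm_on (vec_space (index_set n)) N \<and>
              theta_body (index_set n) (nuclear_ideal p n) k =
                {x \<in> vec_space (index_set n). N x \<le> 1})"
proof -
  have n: "n \<noteq> []" "\<And>i. i < length n \<Longrightarrow> n ! i \<ge> 1" using assms by auto
  have "replicate (length n) 1 \<in> index_set n" using n(2) by (auto simp: index_set_def)
  then have ne: "index_set n \<noteq> {}" by blast
  have conclude: ?thesis
    if V: "V \<subseteq> vec_space (index_set n)"
        "\<And>v. v \<in> V \<Longrightarrow> (\<Sum>a\<in>index_set n. (Poly_Mapping.lookup v a)\<^sup>2) = c"
        "\<And>v. v \<in> V \<Longrightarrow> - v \<in> V"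
      and ball: "nuclear_ball p n = convex hull V"
      and ideal: "nuclear_ideal p n = vanishing_ideal (index_set n) V"
    for V c
  proof -
    have unit: "Poly_Mapping.single a 1 \<in> convex hull V" if "a \<in> index_set n" for a
      using single_in_nuclear_ball[OF assms(1) that] ball by simp
    show ?thesis
      unfolding ball ideal
    proof (intro conjI allI impI; (elim conjE)?)
      show "g ` theta_body (index_set n) (vanishing_ideal (index_set n) V) k =
          theta_body (index_set n) (vanishing_ideal (index_set n) V) k"
        if "linear_automorphism_on (vec_space (index_set n)) g"
            "g ` (convex hull V) = convex hull V" for g
        using finite_index_set assms(5) V(1,2) that by (rule theta_body_image_eq)
      show "\<exists>N. norm_on (vec_space (index_set n)) N \<and>
          theta_body (index_set n) (vanishing_ideal (index_set n) V) k
              = {x \<in> vec_space (index_set n). N x \<le> 1}"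
        using finite_index_set ne assms(5) V unit by (rule theta_body_is_unit_ball)
    qed
  qed
  from assms(1) consider "p = 1" | "p = 2" | "p = \<infinity>" by blast
  then show ?thesis
  proof cases
    case 1
    show ?thesis
    proof (rule conclude[OF signed_units_subset signed_units_square_sum[OF finite_index_set]
        uminus_signed_units])
      show "nuclear_ball p n = convex hull signed_units (index_set n)"
        using 1 nuclear_ball_1[OF n(1)] by simp
      show "nuclear_ideal p n = vanishing_ideal (index_set n) (signed_units (index_set n))"
        using 1 by (simp add: nuclear_ideal_def ideal_1_eq_vanishing_ideal)
    qed
  next
    case 2
    show ?thesis
    proof (rule conclude[OF unit_rank_one_subset unit_rank_one_square_sum
        uminus_unit_rank_one[OF n(1)]])
      show "nuclear_ball p n = convex hull unit_rank_one n"
        using 2 nuclear_ball_2 by simp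
      show "nuclear_ideal p n = vanishing_ideal (index_set n) (unit_rank_one n)"
        using 2 ideal_2_eq_vanishing_ideal[OF n]
            by (simp add: nuclear_ideal_def one_enat_def numeral_eq_enat)
    qed
  next
    case 3
    show ?thesis
    proof (rule conclude[OF sign_tensors_subset sign_tensors_square_sum
        uminus_sign_tensors[OF n(1)]])
      show "nuclear_ball p n = convex hull sign_tensors n"
        using 3 nuclear_ball_inf[OF n(2)] by simp
      show "nuclear_ideal p n = vanishing_ideal (index_set n) (sign_tensors n)"
        using 3 ideal_inf_eq_vanishing_ideal[OF n]
            by (simp add: nuclear_ideal_def one_enat_def numeral_eq_enat)
    qed
  qed
qed

end
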